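(* Let $1<p,q<\infty$, let $B(\ell_p,\ell_q)$ be the Banach space of bounded linear operators from $\ell_p$ to $\ell_q$ with the operator norm, and let $\operatorname{SSD}\{B(\ell_p,\ell_q)\}$ be the set of all $T\in B(\ell_p,\ell_q)$ at which the norm of $B(\ell_p,\ell_q)$ is strongly subdifferentiable. Then $$\{T\in B(\ell_p,\ell_q):\|T\|_e<\|T\|\}\subset \operatorname{SSD}\{B(\ell_p,\ell_q)\}.$$ In particular, $\operatorname{SSD}\{B(\ell_p,\ell_q)\}$ is a dense subset of $B(\ell_p,\ell_q)$.
   Context: Scalars are $\mathbb{F}\in\{\mathbb{R},\mathbb{C}\}$. For a Banach space $X$, $S_X$ and $B_X$ denote its unit sphere and closed unit ball. The norm of $X$ is strongly subdifferentiable at $u\in X$ if $\lim_{t\to0^+}\frac{\|u+tx\|-\|u\|}{t}=\max\{\operatorname{Re}f(x): f\in J_{X^*}(u)\}$ uniformly for $x\in B_X$, where $J_{X^*}(u)=\{f\in S_{X^*}: f(u)=\|u\|\}$. The essential norm $\|T\|_e$ of a bounded linear operator $T:X\to Y$ is the operator-norm distance from $T$ to the space $K(X,Y)$ of compact operators from $X$ to $Y$. *)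

theory Defs
  imports "HOL-Analysis.Analysis" "HOL-Library.Function_Algebras"
begin

text \<open>
  Since \<open>\<ell>\<^sub>p\<close> depends on a real number \<open>p\<close>, normed spaces are represented by explicit carriers:
  a set of vectors in an ambient additive group, a scalar multiplication and a norm.
  Sequences and operators are added pointwise.
\<close>

record ('k, 'v) nspace =
  carr :: "'v set"
  scl :: "'k \<Rightarrow> 'v \<Rightarrow> 'v"
  nrm :: "'v \<Rightarrow> real"

definition unit_ball :: "('k, 'v) nspace \<Rightarrow> 'v set" where
  "unit_ball X = {x \<in> carr X. nrm X x \<le> 1}"

definition norm_topology :: "('k, 'v::ab_group_add) nspace \<Rightarrow> 'v topology" where
  "norm_topology X = Metric_space.mtopology (carr X) (\<lambda>x y. nrm X (x - y))"

definition dense_in :: "('k, 'v::ab_group_add) nspace \<Rightarrow> 'v set \<Rightarrow> bool" where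
  "dense_in X A \<longleftrightarrow> A \<subseteq> carr X \<and> (\<forall>x\<in>carr X. \<forall>\<epsilon>>0. \<exists>a\<in>A. nrm X (x - a) < \<epsilon>)"

definition scalars :: "('k::real_normed_field, 'k) nspace" where
  "scalars = \<lparr>carr = UNIV, scl = (*), nrm = norm\<rparr>"

definition ell :: "real \<Rightarrow> ('k::real_normed_field, nat \<Rightarrow> 'k) nspace" where
  "ell p = \<lparr>carr = {x. summable (\<lambda>n. norm (x n) powr p)},
            scl = (\<lambda>c x n. c * x n),
            nrm = (\<lambda>x. (\<Sum>n. norm (x n) powr p) powr (1 / p))\<rparr>"

text \<open>
  The Banach space \<open>B(X, Y)\<close>. Operators vanish off the carrier of \<open>X\<close>, so that each
  operator is represented by exactly one function.
\<close>

definition bounded_ops ::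
  "('k, 'v::ab_group_add) nspace \<Rightarrow> ('k, 'w::ab_group_add) nspace \<Rightarrow> ('k, 'v \<Rightarrow> 'w) nspace" where
  "bounded_ops X Y =
    \<lparr>carr = {T. (\<forall>x\<in>carr X. T x \<in> carr Y) \<and> (\<forall>x. x \<notin> carr X \<longrightarrow> T x = 0) \<and>
                (\<forall>x\<in>carr X. \<forall>y\<in>carr X. T (x + y) = T x + T y) \<and>
                (\<forall>c. \<forall>x\<in>carr X. T (scl X c x) = scl Y c (T x)) \<and>
                (\<exists>C. \<forall>x\<in>carr X. nrm Y (T x) \<le> C * nrm X x)},
     scl = (\<lambda>c T x. scl Y c (T x)),
     nrm = (\<lambda>T. SUP x\<in>unit_ball X. nrm Y (T x))\<rparr>"

definition dual :: "('k::real_normed_field, 'v::ab_group_add) nspace \<Rightarrow> ('k, 'v \<Rightarrow> 'k) nspace" where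
  "dual X = bounded_ops X scalars"

definition compact_ops ::
  "('k, 'v::ab_group_add) nspace \<Rightarrow> ('k, 'w::ab_group_add) nspace \<Rightarrow> ('v \<Rightarrow> 'w) set" where
  "compact_ops X Y = {K \<in> carr (bounded_ops X Y).
     compactin (norm_topology Y) (norm_topology Y closure_of (K ` unit_ball X))}"

definition ess_norm ::
  "('k, 'v::ab_group_add) nspace \<Rightarrow> ('k, 'w::ab_group_add) nspace \<Rightarrow> ('v \<Rightarrow> 'w) \<Rightarrow> real" where
  "ess_norm X Y T = (INF K\<in>compact_ops X Y. nrm (bounded_ops X Y) (T - K))"

text \<open>The real part, uniformly for real and complex scalars; see the two lemmas below.\<close>

definition re_part :: "'k::{real_normed_field, real_inner} \<Rightarrow> real" where
  "re_part z = inner z 1"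

lemma re_part_real [simp]: "re_part (z::real) = z"
  by (simp add: re_part_def)

lemma re_part_complex [simp]: "re_part (z::complex) = Re z"
  by (simp add: re_part_def inner_complex_def)

definition duality_map ::
  "('k::real_normed_field, 'v::ab_group_add) nspace \<Rightarrow> 'v \<Rightarrow> ('v \<Rightarrow> 'k) set" where
  "duality_map X u = {f \<in> carr (dual X). nrm (dual X) f = 1 \<and> f u = of_real (nrm X u)}"

definition is_maximum :: "real set \<Rightarrow> real \<Rightarrow> bool" where
  "is_maximum A m \<longleftrightarrow> m \<in> A \<and> (\<forall>a\<in>A. a \<le> m)"

definition ssd_at ::
  "('k::{real_normed_field, real_inner}, 'v::ab_group_add) nspace \<Rightarrow> 'v \<Rightarrow> bool" where
  "ssd_at X u \<longleftrightarrow>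
    (\<exists>M. (\<forall>x\<in>unit_ball X. is_maximum ((\<lambda>f. re_part (f x)) ` duality_map X u) (M x)) \<and>
         uniform_limit (unit_ball X)
           (\<lambda>t x. (nrm X (u + scl X (of_real t) x) - nrm X u) / t) M (at_right (0::real)))"

definition SSD :: "('k::{real_normed_field, real_inner}, 'v::ab_group_add) nspace \<Rightarrow> 'v set" where
  "SSD X = {u \<in> carr X. ssd_at X u}"

end

theory Submission
  imports Defs "HOL-Library.Diagonal_Subsequence"
begin

text \<open>
  Let \<open>\<tau> = \<parallel>T\<parallel>\<close> and suppose that \<open>\<parallel>T\<parallel>\<^sub>e < \<tau>\<close>. Everything rests on a compactness property of norming
  sequences: if \<open>x\<^sub>n\<close> lies in the unit ball of \<open>\<ell>\<^sub>p\<close> and \<open>\<parallel>T x\<^sub>n\<parallel> \<rightarrow> \<tau>\<close>, then a subsequence converges in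
  norm (\<open>attaining_subsequence_ell\<close>). Pass to a subsequence that converges coordinatewise to some
  \<open>y\<close>, and put \<open>z\<^sub>n = x\<^sub>n - y\<close>. The operator preserves coordinatewise convergence of bounded sequences
  (\<open>op_pointwise_null\<close>), so the Brezis--Lieb lemma splits both norms in the limit:
  \<open>\<parallel>y\<parallel>\<^sup>p + \<alpha> \<le> 1\<close> and \<open>\<tau>\<^sup>q = \<parallel>T y\<parallel>\<^sup>q + \<beta>\<close>, where \<open>\<alpha> = lim \<parallel>z\<^sub>n\<parallel>\<^sup>p\<close> and \<open>\<beta> = lim \<parallel>T z\<^sub>n\<parallel>\<^sup>q\<close>.
  If \<open>p \<le> q\<close>, choose a compact \<open>K\<close> with \<open>e = \<parallel>T - K\<parallel> < \<tau>\<close>. As \<open>K\<close> maps \<open>z\<^sub>n\<close> to a norm null sequence, along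
  a subsequence, \<open>\<beta> \<le> e\<^sup>q \<alpha>\<^bsup>q/p\<^esup>\<close>. Since the exponent \<open>q/p\<close> is at least one and the numbers lie in
  the unit interval, this forces \<open>\<tau>\<^sup>q \<le> \<tau>\<^sup>q (1 - \<alpha>) + e\<^sup>q \<alpha>\<close>, hence \<open>\<alpha> = 0\<close>. If \<open>q < p\<close>, then
  \<open>\<beta> = 0\<close> by the argument of Pitt's theorem, so \<open>\<parallel>y\<parallel> = 1\<close> and again \<open>\<alpha> = 0\<close>.

  The second ingredient is a selection of the duality map of \<open>\<ell>\<^sub>q\<close> that is norm continuous away from
  zero (\<open>ell_duality_continuous\<close>). Let \<open>J v\<close> denote its value at \<open>v\<close>. A unit vector \<open>x\<close> with
  \<open>\<parallel>T x\<parallel> = \<tau>\<close> yields the functional \<open>S \<mapsto> J (T x) (S x)\<close> in the duality map of the operator space at \<open>T\<close>.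
  If \<open>x\<^sub>n\<close> almost attains the norm of \<open>T + t\<^sub>n S\<^sub>n\<close> and \<open>t\<^sub>n \<rightarrow> 0\<close>, then \<open>x\<^sub>n\<close> is norming for \<open>T\<close>, so along a
  subsequence it converges to such an \<open>x\<close>, and the difference quotient at \<open>S\<^sub>n\<close> exceeds the value of
  this functional at \<open>S\<^sub>n\<close> by at most a null sequence. As no functional in the duality map exceeds
  the quotient, this gives the attained maximum and the uniformity at once.
  This part uses no sequence spaces (locale \<open>compactly_attaining_op\<close>).

  For density, add to \<open>T\<close> a small rank one operator that lengthens the image of an almost norming
  vector: the norm becomes larger than \<open>\<parallel>T\<parallel>\<close>, whereas the essential norm stays at most \<open>\<parallel>T\<parallel>\<close>.

  The sign of a nonzero scalar \<open>a\<close> is inverted by \<open>\<bar>a\<bar> / a\<close>, so no conjugation is needed and the real and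
  the complex case have the same proof.
\<close>

section \<open>Normed spaces with explicit carriers and their operators\<close>

text \<open>
  The records of type \<open>nspace\<close> carry no axioms. With the axioms collected here, one set of lemmas
  serves \<open>\<ell>\<^sub>p\<close>, the operator spaces and all their duals.
\<close>

locale normed_carrier =
  fixes X :: "('k::real_normed_field, 'v::ab_group_add) nspace"
  assumes zero_closed [simp]: "0 \<in> carr X"
    and add_closed [simp]: "x \<in> carr X \<Longrightarrow> y \<in> carr X \<Longrightarrow> x + y \<in> carr X"
    and scl_closed [simp]: "x \<in> carr X \<Longrightarrow> scl X c x \<in> carr X"
    and scl_add_right: "x \<in> carr X \<Longrightarrow> y \<in> carr X \<Longrightarrow> scl X c (x + y) = scl X c x + scl X c y"
    and scl_add_left: "x \<in> carr X \<Longrightarrow> scl X (c + d) x = scl X c x + scl X d x"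
    and scl_scl: "x \<in> carr X \<Longrightarrow> scl X c (scl X d x) = scl X (c * d) x"
    and scl_one [simp]: "x \<in> carr X \<Longrightarrow> scl X 1 x = x"
    and nrm_scl: "x \<in> carr X \<Longrightarrow> nrm X (scl X c x) = norm c * nrm X x"
    and nrm_triangle: "x \<in> carr X \<Longrightarrow> y \<in> carr X \<Longrightarrow> nrm X (x + y) \<le> nrm X x + nrm X y"
    and nrm_eq_0: "x \<in> carr X \<Longrightarrow> nrm X x = 0 \<Longrightarrow> x = 0"
begin

lemma scl_zero_left [simp]: "x \<in> carr X \<Longrightarrow> scl X 0 x = 0"
  using scl_add_left[of x 0 0] by simp

lemma scl_zero_right [simp]: "scl X c 0 = 0"
  using scl_add_right[of 0 0 c] by simp

lemma scl_minus_one: "x \<in> carr X \<Longrightarrow> scl X (-1) x = - x"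
  using scl_add_left[of x "-1" 1] by (simp add: eq_neg_iff_add_eq_0)

lemma uminus_closed [simp]: "x \<in> carr X \<Longrightarrow> - x \<in> carr X"
  by (metis scl_closed scl_minus_one)

lemma diff_closed [simp]: "x \<in> carr X \<Longrightarrow> y \<in> carr X \<Longrightarrow> x - y \<in> carr X"
  by (metis add_closed diff_conv_add_uminus uminus_closed)

lemma nrm_zero [simp]: "nrm X 0 = 0"
  using nrm_scl[of 0 0] by simp

lemma nrm_minus [simp]: "x \<in> carr X \<Longrightarrow> nrm X (- x) = nrm X x"
  by (metis mult_1 nrm_scl norm_minus_cancel norm_one scl_minus_one)

lemma nrm_minus_commute:
  assumes "x \<in> carr X" "y \<in> carr X"
  shows "nrm X (x - y) = nrm X (y - x)"
  using nrm_minus[of "x - y"] assms by simp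

lemma nrm_nonneg [simp]: "x \<in> carr X \<Longrightarrow> 0 \<le> nrm X x"
  using nrm_triangle[of x "- x"] by simp

lemma nrm_triangle_diff:
  assumes "x \<in> carr X" "y \<in> carr X"
  shows "nrm X x - nrm X y \<le> nrm X (x - y)"
  using nrm_triangle[of "x - y" y] assms by simp

lemma abs_nrm_diff_le:
  assumes "x \<in> carr X" "y \<in> carr X"
  shows "\<bar>nrm X x - nrm X y\<bar> \<le> nrm X (x - y)"
  using nrm_triangle_diff[of x y] nrm_triangle_diff[of y x] nrm_minus_commute[of x y] assms
  by linarith

lemma tendsto_nrm:
  assumes "\<And>n. x n \<in> carr X" "x0 \<in> carr X" "((\<lambda>n. nrm X (x n - x0)) \<longlongrightarrow> 0) F"
  shows "((\<lambda>n. nrm X (x n)) \<longlongrightarrow> nrm X x0) F"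
proof -
  have "((\<lambda>n. nrm X (x n) - nrm X x0) \<longlongrightarrow> 0) F"
    by (rule Lim_null_comparison[OF _ assms(3)]) (simp add: assms abs_nrm_diff_le)
  then show ?thesis
    by (simp add: LIM_zero_iff)
qed

lemma mem_unit_ball: "x \<in> unit_ball X \<longleftrightarrow> x \<in> carr X \<and> nrm X x \<le> 1"
  by (simp add: unit_ball_def)

lemma zero_in_unit_ball [simp]: "0 \<in> unit_ball X"
  by (simp add: mem_unit_ball)

end

locale normed_carrier_pair = X: normed_carrier X + Y: normed_carrier Y
  for X :: "('k::real_normed_field, 'v::ab_group_add) nspace"
    and Y :: "('k, 'w::ab_group_add) nspace"
begin

abbreviation B :: "('k, 'v \<Rightarrow> 'w) nspace" where
  "B \<equiv> bounded_ops X Y"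

lemma carr_B:
  "T \<in> carr B \<longleftrightarrow> (\<forall>x\<in>carr X. T x \<in> carr Y) \<and> (\<forall>x. x \<notin> carr X \<longrightarrow> T x = 0) \<and>
     (\<forall>x\<in>carr X. \<forall>y\<in>carr X. T (x + y) = T x + T y) \<and>
     (\<forall>c. \<forall>x\<in>carr X. T (scl X c x) = scl Y c (T x)) \<and>
     (\<exists>C. \<forall>x\<in>carr X. nrm Y (T x) \<le> C * nrm X x)"
  by (simp add: bounded_ops_def)

lemma nrm_B: "nrm B T = (SUP x\<in>unit_ball X. nrm Y (T x))"
  by (simp add: bounded_ops_def)

lemma scl_B: "scl B c T = (\<lambda>x. scl Y c (T x))"
  by (simp add: bounded_ops_def)

lemma op_closed: "T \<in> carr B \<Longrightarrow> T x \<in> carr Y"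
  using carr_B[of T] by (cases "x \<in> carr X") auto

lemma op_outside: "T \<in> carr B \<Longrightarrow> x \<notin> carr X \<Longrightarrow> T x = 0"
  using carr_B[of T] by auto

lemma op_add: "T \<in> carr B \<Longrightarrow> x \<in> carr X \<Longrightarrow> y \<in> carr X \<Longrightarrow> T (x + y) = T x + T y"
  using carr_B[of T] by auto

lemma op_scl: "T \<in> carr B \<Longrightarrow> x \<in> carr X \<Longrightarrow> T (scl X c x) = scl Y c (T x)"
  using carr_B[of T] by auto

lemma op_diff:
  assumes "T \<in> carr B" "x \<in> carr X" "y \<in> carr X"
  shows "T (x - y) = T x - T y"
  using op_add[of T "x - y" y] assms by (simp add: eq_diff_eq)

lemma op_zero: "T \<in> carr B \<Longrightarrow> T 0 = 0"
  using op_diff[of T 0 0] by simp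

lemma bdd_above_op:
  assumes "T \<in> carr B"
  shows "bdd_above ((\<lambda>x. nrm Y (T x)) ` unit_ball X)"
proof -
  obtain C where C: "\<And>x. x \<in> carr X \<Longrightarrow> nrm Y (T x) \<le> C * nrm X x"
    using carr_B[of T] assms by blast
  have "nrm Y (T x) \<le> \<bar>C\<bar>" if "x \<in> unit_ball X" for x
  proof -
    have x: "x \<in> carr X" "nrm X x \<le> 1"
      using that by (auto simp: X.mem_unit_ball)
    have "nrm Y (T x) \<le> \<bar>C\<bar> * nrm X x"
      using C[OF x(1)] mult_right_mono[OF abs_ge_self[of C] X.nrm_nonneg[OF x(1)]] by linarith
    also have "\<dots> \<le> \<bar>C\<bar>"
      using x by (simp add: mult_left_le)
    finally show ?thesis .
  qed
  then show ?thesis by (rule bdd_aboveI2)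
qed

lemma op_norm_upper:
  assumes "T \<in> carr B" "x \<in> unit_ball X"
  shows "nrm Y (T x) \<le> nrm B T"
  unfolding nrm_B using cSUP_upper[OF assms(2) bdd_above_op[OF assms(1)]] .

lemma op_norm_least:
  assumes "\<And>x. x \<in> unit_ball X \<Longrightarrow> nrm Y (T x) \<le> C"
  shows "nrm B T \<le> C"
  unfolding nrm_B by (rule cSUP_least) (use assms X.zero_in_unit_ball in blast)+

lemma op_norm_nonneg: "T \<in> carr B \<Longrightarrow> 0 \<le> nrm B T"
  using op_norm_upper[of T 0] op_zero[of T] by simp

lemma op_norm_approx:
  assumes "T \<in> carr B" "d < nrm B T"
  obtains x where "x \<in> unit_ball X" "d < nrm Y (T x)"
proof -
  have "unit_ball X \<noteq> {}"
    using X.zero_in_unit_ball by blast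
  then show ?thesis
    using assms that less_cSUP_iff[OF _ bdd_above_op] unfolding nrm_B by blast
qed

lemma op_norm_bound:
  assumes T: "T \<in> carr B" and x: "x \<in> carr X"
  shows "nrm Y (T x) \<le> nrm B T * nrm X x"
proof (cases "x = 0")
  case True
  then show ?thesis using op_zero[OF T] by simp
next
  case False
  then have pos: "nrm X x > 0"
    using x X.nrm_eq_0[of x] X.nrm_nonneg[of x] by (auto simp: less_le)
  define y where "y = scl X (of_real (1 / nrm X x)) x"
  have "y \<in> unit_ball X"
    using x pos by (simp add: y_def X.mem_unit_ball X.nrm_scl norm_divide)
  then have "nrm Y (T y) \<le> nrm B T"
    using op_norm_upper T by blast
  moreover have "nrm Y (T y) = nrm Y (T x) / nrm X x"
    using x pos T by (simp add: y_def op_scl Y.nrm_scl op_closed norm_divide)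
  ultimately show ?thesis
    using pos by (simp add: divide_le_eq)
qed

lemma op_ball_bound:
  assumes "S \<in> unit_ball B" "x \<in> unit_ball X"
  shows "nrm Y (S x) \<le> 1"
  using op_norm_upper[of S x] assms by (simp add: unit_ball_def)

lemma opI:
  assumes "\<And>x. x \<in> carr X \<Longrightarrow> T x \<in> carr Y" "\<And>x. x \<notin> carr X \<Longrightarrow> T x = 0"
    and "\<And>x y. x \<in> carr X \<Longrightarrow> y \<in> carr X \<Longrightarrow> T (x + y) = T x + T y"
    and "\<And>c x. x \<in> carr X \<Longrightarrow> T (scl X c x) = scl Y c (T x)"
    and "\<And>x. x \<in> carr X \<Longrightarrow> nrm Y (T x) \<le> C * nrm X x"
  shows "T \<in> carr B"
  using assms carr_B[of T] by blast

lemma op_norm_le: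
  assumes "0 \<le> C" "\<And>x. x \<in> carr X \<Longrightarrow> nrm Y (T x) \<le> C * nrm X x"
  shows "nrm B T \<le> C"
proof (rule op_norm_least)
  fix x assume "x \<in> unit_ball X"
  then have "x \<in> carr X" "nrm X x \<le> 1"
    by (auto simp: X.mem_unit_ball)
  then show "nrm Y (T x) \<le> C"
    using assms(2)[of x] mult_left_le[of "nrm X x" C] assms(1) by linarith
qed

lemma normed_carrier_ops: "normed_carrier B"
proof
  show zero: "0 \<in> carr B"
    by (rule opI[where C = 0]) auto
  show add: "S + T \<in> carr B" if ST: "S \<in> carr B" "T \<in> carr B" for S T
  proof (rule opI[where C = "nrm B S + nrm B T"])
    fix x assume x: "x \<in> carr X"
    show "nrm Y ((S + T) x) \<le> (nrm B S + nrm B T) * nrm X x"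
      using Y.nrm_triangle[of "S x" "T x"] op_norm_bound[OF ST(1) x] op_norm_bound[OF ST(2) x] ST
      by (simp add: op_closed algebra_simps)
  qed (use ST in \<open>auto simp: op_closed op_outside op_add op_scl Y.scl_add_right algebra_simps\<close>)
  show scl: "scl B c T \<in> carr B" if T: "T \<in> carr B" for c T
  proof (rule opI[where C = "norm c * nrm B T"])
    fix x assume x: "x \<in> carr X"
    show "nrm Y (scl B c T x) \<le> norm c * nrm B T * nrm X x"
      using op_norm_bound[OF T x] T
      by (simp add: scl_B Y.nrm_scl op_closed mult.assoc mult_left_mono)
  qed (use T in \<open>auto simp: scl_B op_closed op_outside op_add op_scl Y.scl_add_right Y.scl_scl
        mult.commute\<close>)
  show "scl B c (S + T) = scl B c S + scl B c T" if "S \<in> carr B" "T \<in> carr B" for c S T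
    using that by (auto simp: scl_B Y.scl_add_right op_closed)
  show "scl B (c + d) T = scl B c T + scl B d T" if "T \<in> carr B" for c d T
    using that by (auto simp: scl_B Y.scl_add_left op_closed)
  show "scl B c (scl B d T) = scl B (c * d) T" if "T \<in> carr B" for c d T
    using that by (auto simp: scl_B Y.scl_scl op_closed)
  show "scl B 1 T = T" if "T \<in> carr B" for T
    using that by (auto simp: scl_B op_closed)
  show nrm_le: "nrm B (scl B c T) = norm c * nrm B T" if T: "T \<in> carr B" for c T
  proof (rule antisym)
    have le: "nrm B (scl B c T) \<le> norm c * nrm B T" if "T \<in> carr B" for c T
      using that op_norm_bound[OF that] op_norm_nonneg[OF that]
      by (intro op_norm_le)
        (auto simp: scl_B Y.nrm_scl op_closed mult.assoc intro!: mult_left_mono)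
    show "nrm B (scl B c T) \<le> norm c * nrm B T"
      using le T .
    \<comment> \<open>Apply the inequality just proved to \<open>c\<inverse>\<close> and the operator \<open>c T\<close>.\<close>
    show "norm c * nrm B T \<le> nrm B (scl B c T)"
    proof (cases "c = 0")
      case True
      then show ?thesis
        using op_norm_nonneg[OF scl[OF T]] by simp
    next
      case False
      have "scl B (inverse c) (scl B c T) = T"
        using T False by (auto simp: scl_B Y.scl_scl op_closed)
      then have "nrm B T \<le> norm (inverse c) * nrm B (scl B c T)"
        using le[OF scl[OF T], of "inverse c" c] by simp
      then show ?thesis
        using False by (simp add: norm_divide divide_simps mult.commute split: if_splits)
    qed
  qed
  show "nrm B (S + T) \<le> nrm B S + nrm B T" if ST: "S \<in> carr B" "T \<in> carr B" for S T
  proof (rule op_norm_least)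
    fix x assume x: "x \<in> unit_ball X"
    show "nrm Y ((S + T) x) \<le> nrm B S + nrm B T"
      using Y.nrm_triangle[of "S x" "T x"] op_norm_upper[OF ST(1) x] op_norm_upper[OF ST(2) x] ST
      by (simp add: op_closed)
  qed
  show "T = 0" if T: "T \<in> carr B" "nrm B T = 0" for T
  proof
    fix x
    have "T x = 0" if "x \<in> carr X"
      using op_norm_bound[OF T(1) that] T Y.nrm_eq_0[of "T x"] Y.nrm_nonneg[OF op_closed[OF T(1)], of x]
      by (simp add: op_closed)
    then show "T x = 0 x"
      using op_outside[OF T(1), of x] by auto
  qed
qed

end

lemma carr_scalars [simp]: "carr scalars = UNIV"
  and scl_scalars [simp]: "scl scalars = (*)"
  and nrm_scalars [simp]: "nrm scalars = norm"
  by (simp_all add: scalars_def)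

lemma normed_carrier_scalars: "normed_carrier scalars"
  by standard (auto simp: algebra_simps norm_mult norm_triangle_ineq)

section \<open>A sufficient condition for strong subdifferentiability at an operator\<close>

lemma re_part_of_real [simp]: "re_part (of_real r :: 'k::{real_normed_field, real_inner}) = r"
proof -
  have "inner (1::'k) 1 = 1"
    using dot_square_norm[of "1::'k"] by simp
  then show ?thesis
    by (simp add: re_part_def of_real_def)
qed

lemma re_part_add: "re_part (a + b) = re_part a + re_part b"
  by (simp add: re_part_def inner_add_left)

lemma re_part_diff: "re_part (a - b) = re_part a - re_part b"
  by (simp add: re_part_def inner_diff_left)

lemma re_part_of_real_mult: "re_part (of_real r * a) = r * re_part a"
  by (simp add: re_part_def flip: scaleR_conv_of_real)

lemma abs_re_part_le: "\<bar>re_part a\<bar> \<le> norm a"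
  using Cauchy_Schwarz_ineq2[of a 1] by (simp add: re_part_def)

lemma re_part_le: "re_part a \<le> norm a"
  using abs_re_part_le[of a] by linarith

lemma (in normed_carrier) normed_carrier_pair_dual: "normed_carrier_pair X scalars"
  by (simp add: normed_carrier_pair_def normed_carrier_axioms normed_carrier_scalars)

lemma (in normed_carrier) dual_bound:
  assumes "f \<in> carr (dual X)" "x \<in> carr X"
  shows "norm (f x) \<le> nrm (dual X) f * nrm X x"
proof -
  interpret D: normed_carrier_pair X scalars
    by (rule normed_carrier_pair_dual)
  show ?thesis
    using D.op_norm_bound[of f x] assms by (simp add: dual_def)
qed

text \<open>
  This is half of strong subdifferentiability: evaluate the norm one functional at \<open>u + t x\<close>,
  where it gives \<open>\<parallel>u\<parallel> + t f x\<close>.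
\<close>

lemma re_part_duality_map_le_quotient:
  fixes X :: "('k::{real_normed_field, real_inner}, 'v::ab_group_add) nspace"
  assumes "normed_carrier X" and f: "f \<in> duality_map X u"
    and u: "u \<in> carr X" and x: "x \<in> carr X" and t: "0 < t"
  shows "re_part (f x) \<le> (nrm X (u + scl X (of_real t) x) - nrm X u) / t"
proof -
  interpret normed_carrier X by fact
  interpret D: normed_carrier_pair X scalars
    by (rule normed_carrier_pair_dual)
  have fc: "f \<in> carr (dual X)" "nrm (dual X) f = 1" "f u = of_real (nrm X u)"
    using f by (auto simp: duality_map_def)
  have "f (u + scl X (of_real t) x) = of_real (nrm X u) + of_real t * f x"
    using fc u x D.op_add[of f u "scl X (of_real t) x"] D.op_scl[of f x "of_real t"]
    by (simp add: dual_def)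
  then have "nrm X u + t * re_part (f x) = re_part (f (u + scl X (of_real t) x))"
    by (simp add: re_part_add re_part_of_real_mult)
  also have "\<dots> \<le> nrm X (u + scl X (of_real t) x)"
    using re_part_le[of "f (u + scl X (of_real t) x)"] dual_bound[OF fc(1), of "u + scl X (of_real t) x"]
      u x fc(2) by simp
  finally show ?thesis
    using t by (simp add: field_simps)
qed

text \<open>
  Here \<open>D\<close> selects a norming functional for each vector of \<open>Y\<close>, continuously in the norms at every
  nonzero vector. For a sequence that tends to such a vector, finitely many terms may vanish; it
  suffices that \<open>D\<close> takes some value in the dual there.
\<close>

locale compactly_attaining_op = normed_carrier_pair X Y
  for X :: "('k::{real_normed_field, real_inner}, 'v::ab_group_add) nspace"
    and Y :: "('k, 'w::ab_group_add) nspace" +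
  fixes T :: "'v \<Rightarrow> 'w" and D :: "'w \<Rightarrow> 'w \<Rightarrow> 'k"
  assumes T: "T \<in> carr B"
    and T_pos: "0 < nrm B T"
    and attaining_subsequence: "\<And>x. (\<And>n. x n \<in> unit_ball X) \<Longrightarrow>
      (\<lambda>n. nrm Y (T (x n))) \<longlonglongrightarrow> nrm B T \<Longrightarrow>
      \<exists>r x0. strict_mono r \<and> x0 \<in> unit_ball X \<and> (\<lambda>n. nrm X (x (r n) - x0)) \<longlonglongrightarrow> 0"
    and D_closed: "\<And>v. v \<in> carr Y \<Longrightarrow> D v \<in> carr (dual Y)"
    and D_duality: "\<And>v. v \<in> carr Y \<Longrightarrow> v \<noteq> 0 \<Longrightarrow> D v \<in> duality_map Y v"
    and D_continuous: "\<And>v v0. (\<And>n. v n \<in> carr Y) \<Longrightarrow> v0 \<in> carr Y \<Longrightarrow> v0 \<noteq> 0 \<Longrightarrow>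
      (\<lambda>n. nrm Y (v n - v0)) \<longlonglongrightarrow> 0 \<Longrightarrow> (\<lambda>n. nrm (dual Y) (D (v n) - D v0)) \<longlonglongrightarrow> 0"
begin

text \<open>
  If \<open>T\<close> attains its norm at \<open>x\<close>, this functional norms \<open>T\<close> in the operator space.
\<close>

definition norming_functional :: "'v \<Rightarrow> ('v \<Rightarrow> 'w) \<Rightarrow> 'k" where
  "norming_functional x S = (if S \<in> carr B then D (T x) (S x) else 0)"

sublocale Bs: normed_carrier B
  by (rule normed_carrier_ops)

sublocale dY: normed_carrier_pair Y scalars
  by (rule Y.normed_carrier_pair_dual)

sublocale dB: normed_carrier_pair B scalars
  by (rule Bs.normed_carrier_pair_dual)

sublocale dYs: normed_carrier "dual Y"
  unfolding dual_def by (rule dY.normed_carrier_ops)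

lemma D_bound:
  assumes "v \<in> carr Y" "v \<noteq> 0" "h \<in> carr Y"
  shows "norm (D v h) \<le> nrm Y h"
  using Y.dual_bound[of "D v" h] D_duality[of v] assms by (simp add: duality_map_def)

lemma norming_functional_in_duality_map:
  assumes x: "x \<in> unit_ball X" and Tx: "nrm Y (T x) = nrm B T"
  shows "norming_functional x \<in> duality_map B T"
proof -
  have xc: "x \<in> carr X" "nrm X x \<le> 1"
    using x by (auto simp: X.mem_unit_ball)
  have Tx0: "T x \<in> carr Y" "T x \<noteq> 0"
    using Tx T_pos T by (auto simp: op_closed)
  note DTx = D_closed[OF Tx0(1), unfolded dual_def]
  have bound: "norm (norming_functional x S) \<le> 1 * nrm B S" if S: "S \<in> carr B" for S
    using D_bound[OF Tx0, of "S x"] op_norm_upper[OF S x] S by (simp add: norming_functional_def op_closed)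
  have norming_functional: "norming_functional x \<in> carr (dual B)"
    unfolding dual_def
    using bound DTx dY.op_add[OF DTx] dY.op_scl[OF DTx] Bs.scl_closed
    by (intro dB.opI[where C = 1]) (auto simp: norming_functional_def op_closed scl_B)
  have GT: "norming_functional x T = of_real (nrm B T)"
    using D_duality[OF Tx0] Tx T by (simp add: norming_functional_def duality_map_def)
  have "nrm (dual B) (norming_functional x) \<le> 1"
    unfolding dual_def using bound by (intro dB.op_norm_le) auto
  moreover have "nrm B T \<le> nrm (dual B) (norming_functional x) * nrm B T"
    using Bs.dual_bound[OF norming_functional T] GT T_pos by simp
  ultimately have "nrm (dual B) (norming_functional x) = 1"
    using T_pos by simp
  with norming_functional GT show ?thesis
    by (simp add: duality_map_def)
qed

text \<open>
  Choose \<open>x\<^sub>n\<close> in the unit ball so that \<open>T + t\<^sub>n S\<^sub>n\<close> almost attains its norm there, with an error that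
  is \<open>o(t\<^sub>n)\<close>, and put \<open>v\<^sub>n = (T + t\<^sub>n S\<^sub>n) x\<^sub>n\<close>. Then \<open>D v\<^sub>n\<close> is at most \<open>\<parallel>T\<parallel>\<close> at \<open>T x\<^sub>n\<close>, and so
  the difference quotient is at most the real part of \<open>D v\<^sub>n (S\<^sub>n x\<^sub>n)\<close> up to \<open>o(1)\<close>. Now \<open>x\<^sub>n\<close>
  and \<open>v\<^sub>n\<close> converge along a subsequence, and \<open>D\<close> is continuous; the estimate is uniform in \<open>S\<^sub>n\<close> because
  these operators have norm at most one.
\<close>

lemma quotient_subsequence:
  assumes t: "\<And>n. 0 < t n" "t \<longlonglongrightarrow> 0" and S: "\<And>n. S n \<in> unit_ball B"
  obtains r x0 \<delta> where "strict_mono r" "x0 \<in> unit_ball X" "nrm Y (T x0) = nrm B T" "\<delta> \<longlonglongrightarrow> 0"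
    "\<forall>\<^sub>F n in sequentially. (nrm B (T + scl B (of_real (t (r n))) (S (r n))) - nrm B T) / t (r n)
       \<le> re_part (norming_functional x0 (S (r n))) + \<delta> n"
proof -
  define \<tau> where "\<tau> = nrm B T"
  define U where "U n = T + scl B (of_real (t n)) (S n)" for n
  have Sc: "S n \<in> carr B" "nrm B (S n) \<le> 1" for n
    using S by (auto simp: Bs.mem_unit_ball)
  have U: "U n \<in> carr B" for n
    using T Sc by (simp add: U_def)
  have "\<exists>x. x \<in> unit_ball X \<and> nrm B (U n) - (t n)\<^sup>2 < nrm Y (U n x)" for n
  proof -
    have "nrm B (U n) - (t n)\<^sup>2 < nrm B (U n)"
      using t(1)[of n] by simp
    then show ?thesis
      using op_norm_approx[OF U] by blast
  qed
  \<comment> \<open>The error \<open>(t n)\<^sup>2\<close> is still negligible after division by \<open>t n\<close>.\<close>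
  then obtain x where x: "\<And>n. x n \<in> unit_ball X"
      and xU: "\<And>n. nrm B (U n) - (t n)\<^sup>2 < nrm Y (U n (x n))"
    by metis
  have xc: "x n \<in> carr X" for n
    using x by (simp add: X.mem_unit_ball)
  define v where "v n = U n (x n)" for n
  have v: "v n = T (x n) + scl Y (of_real (t n)) (S n (x n))" for n
    by (simp add: v_def U_def scl_B)
  have Sx: "S n (x n) \<in> carr Y" "nrm Y (S n (x n)) \<le> 1" for n
    using op_closed[OF Sc(1)] op_ball_bound[OF S x] by auto
  have Txc: "T y \<in> carr Y" for y
    using T by (rule op_closed)
  have vc: "v n \<in> carr Y" for n
    by (simp add: v Txc Sx)
  have tS: "nrm Y (scl Y (of_real (t n)) (S n (x n))) \<le> t n" for n
    using t(1)[of n] Sx[of n] by (simp add: Y.nrm_scl)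
  have U_ge: "\<tau> - t n \<le> nrm B (U n)" for n
  proof -
    have "nrm B (scl B (of_real (t n)) (S n)) \<le> t n"
      using t(1)[of n] Sc[of n] by (simp add: Bs.nrm_scl)
    moreover have "\<tau> - nrm B (U n) \<le> nrm B (T - U n)"
      unfolding \<tau>_def by (rule Bs.nrm_triangle_diff[OF T U])
    moreover have "nrm B (T - U n) = nrm B (scl B (of_real (t n)) (S n))"
      using Bs.nrm_minus[of "scl B (of_real (t n)) (S n)"] Sc by (simp add: U_def)
    ultimately show ?thesis by linarith
  qed
  have Tx_le: "nrm Y (T (x n)) \<le> \<tau>" for n
    unfolding \<tau>_def using op_norm_upper[OF T x] .
  have Tx_ge: "\<tau> - 2 * t n - (t n)\<^sup>2 \<le> nrm Y (T (x n))" for n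
    using U_ge[of n] xU[of n] tS[of n] Y.nrm_triangle[OF Txc, of "scl Y (of_real (t n)) (S n (x n))" "x n"]
    by (simp add: Sx flip: v v_def)
  have "(\<lambda>n. nrm Y (T (x n))) \<longlonglongrightarrow> \<tau>"
  proof (rule tendsto_sandwich[OF _ _ _ tendsto_const])
    show "(\<lambda>n. \<tau> - 2 * t n - (t n)\<^sup>2) \<longlonglongrightarrow> \<tau>"
      using t(2) by (auto intro!: tendsto_eq_intros)
  qed (use Tx_ge Tx_le in auto)
  then obtain r x0 where r: "strict_mono r" and x0: "x0 \<in> unit_ball X"
      and lim: "(\<lambda>n. nrm X (x (r n) - x0)) \<longlonglongrightarrow> 0"
    using attaining_subsequence[of x, OF x] unfolding \<tau>_def by blast
  have x0c: "x0 \<in> carr X"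
    using x0 by (simp add: X.mem_unit_ball)
  have tr: "(\<lambda>n. t (r n)) \<longlonglongrightarrow> 0"
    using LIMSEQ_subseq_LIMSEQ[OF t(2) r] by (simp add: o_def)
  have Tdiff: "nrm Y (T (x (r n)) - T x0) \<le> \<tau> * nrm X (x (r n) - x0)" for n
    using op_norm_bound[OF T, of "x (r n) - x0"] op_diff[OF T xc x0c] xc x0c by (simp add: \<tau>_def)
  have Tlim: "(\<lambda>n. nrm Y (T (x (r n)) - T x0)) \<longlonglongrightarrow> 0"
  proof (rule tendsto_sandwich[OF _ _ tendsto_const])
    show "(\<lambda>n. \<tau> * nrm X (x (r n) - x0)) \<longlonglongrightarrow> 0"
      using lim by (auto intro!: tendsto_eq_intros)
  qed (use Tdiff Txc in auto)
  have Tx0: "nrm Y (T x0) = \<tau>"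
  proof (rule LIMSEQ_unique)
    show "(\<lambda>n. nrm Y (T (x (r n)))) \<longlonglongrightarrow> nrm Y (T x0)"
      using Y.tendsto_nrm[OF _ _ Tlim] Txc by blast
    show "(\<lambda>n. nrm Y (T (x (r n)))) \<longlonglongrightarrow> \<tau>"
      using LIMSEQ_subseq_LIMSEQ[OF \<open>(\<lambda>n. nrm Y (T (x n))) \<longlonglongrightarrow> \<tau>\<close> r] by (simp add: o_def)
  qed
  have Tx0_ne: "T x0 \<noteq> 0"
    using Tx0 T_pos \<tau>_def by auto
  have vlim: "(\<lambda>n. nrm Y (v (r n) - T x0)) \<longlonglongrightarrow> 0"
  proof (rule tendsto_sandwich[OF _ _ tendsto_const])
    show "(\<lambda>n. nrm Y (T (x (r n)) - T x0) + t (r n)) \<longlonglongrightarrow> 0"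
      using tendsto_add[OF Tlim tr] by simp
    have "nrm Y (v (r n) - T x0) \<le> nrm Y (T (x (r n)) - T x0) + t (r n)" for n
      using Y.nrm_triangle[of "T (x (r n)) - T x0" "scl Y (of_real (t (r n))) (S (r n) (x (r n)))"]
        tS[of "r n"] by (simp add: v Sx Txc algebra_simps)
    then show "\<forall>\<^sub>F n in sequentially. nrm Y (v (r n) - T x0) \<le> nrm Y (T (x (r n)) - T x0) + t (r n)"
      by simp
  qed (simp add: vc Txc)
  have Dlim: "(\<lambda>n. nrm (dual Y) (D (v (r n)) - D (T x0))) \<longlonglongrightarrow> 0"
    by (rule D_continuous) (use vc Txc Tx0_ne vlim in auto)
  have ev: "\<forall>\<^sub>F n in sequentially. v (r n) \<noteq> 0"
  proof -
    have "(\<lambda>n. nrm Y (v (r n))) \<longlonglongrightarrow> nrm Y (T x0)"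
      using Y.tendsto_nrm[OF _ _ vlim] vc Txc by blast
    then have "\<forall>\<^sub>F n in sequentially. 0 < nrm Y (v (r n))"
      using T_pos Tx0 by (intro order_tendstoD) (auto simp: \<tau>_def)
    then show ?thesis
      by eventually_elim auto
  qed
  define \<delta> where
    "\<delta> n = nrm (dual Y) (D (v (r n)) - D (T x0)) + nrm X (x (r n) - x0) + t (r n)" for n
  have "\<delta> \<longlonglongrightarrow> 0"
    unfolding \<delta>_def using tendsto_add[OF tendsto_add[OF Dlim lim] tr] by simp
  moreover have "\<forall>\<^sub>F n in sequentially. (nrm B (U (r n)) - \<tau>) / t (r n)
       \<le> re_part (norming_functional x0 (S (r n))) + \<delta> n"
    using ev
  proof eventually_elim
    case (elim n)
    define m where "m = r n"
    have vm: "v m \<noteq> 0"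
      using elim by (simp add: m_def)
    have Dvm: "D (v m) \<in> carr (bounded_ops Y scalars)" "D (T x0) \<in> carr (bounded_ops Y scalars)"
      using D_closed vc Txc by (auto simp: dual_def)
    have "D (v m) (v m) = of_real (nrm Y (v m))"
      using D_duality[OF vc vm] by (simp add: duality_map_def)
    moreover have "D (v m) (v m) = D (v m) (T (x m)) + of_real (t m) * D (v m) (S m (x m))"
      using dY.op_add[OF Dvm(1), of "T (x m)" "scl Y (of_real (t m)) (S m (x m))"]
        dY.op_scl[OF Dvm(1), of "S m (x m)" "of_real (t m)"] by (simp add: v Txc Sx)
    ultimately have "nrm Y (v m) = re_part (D (v m) (T (x m))) + t m * re_part (D (v m) (S m (x m)))"
      by (metis re_part_add re_part_of_real re_part_of_real_mult)
    moreover have "re_part (D (v m) (T (x m))) \<le> \<tau>"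
      using re_part_le[of "D (v m) (T (x m))"] D_bound[OF vc vm Txc, of "x m"] Tx_le[of m] by linarith
    ultimately have "nrm B (U m) - \<tau> \<le> (re_part (D (v m) (S m (x m))) + t m) * t m"
      using xU[of m] by (simp add: v_def algebra_simps power2_eq_square)
    then have quot: "(nrm B (U m) - \<tau>) / t m \<le> re_part (D (v m) (S m (x m))) + t m"
      using t(1)[of m] by (simp add: divide_le_eq)
    \<comment> \<open>First replace the functional \<open>D (v m)\<close> by its limit, then the vector \<open>x m\<close>.\<close>
    have "norm (D (v m) (S m (x m)) - D (T x0) (S m (x m)))
        \<le> nrm (dual Y) (D (v m) - D (T x0)) * nrm Y (S m (x m))"
      using Y.dual_bound[of "D (v m) - D (T x0)" "S m (x m)"] D_closed vc Txc Sx by simp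
    also have "\<dots> \<le> nrm (dual Y) (D (v m) - D (T x0))"
      using Sx D_closed vc Txc by (simp add: mult_left_le)
    finally have 1: "norm (D (v m) (S m (x m)) - D (T x0) (S m (x m)))
        \<le> nrm (dual Y) (D (v m) - D (T x0))" .
    have "D (T x0) (S m (x m)) - D (T x0) (S m x0) = D (T x0) (S m (x m - x0))"
      using dY.op_diff[OF Dvm(2)] op_diff[OF Sc(1)] op_closed[OF Sc(1)] xc x0c by simp
    also have "norm \<dots> \<le> nrm Y (S m (x m - x0))"
      using D_bound[OF Txc Tx0_ne] op_closed[OF Sc(1)] by blast
    also have "\<dots> \<le> nrm B (S m) * nrm X (x m - x0)"
      using op_norm_bound[OF Sc(1)] xc x0c by simp
    also have "\<dots> \<le> nrm X (x m - x0)"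
      using Sc[of m] xc x0c by (simp add: mult_left_le_one_le)
    finally have 2: "norm (D (T x0) (S m (x m)) - D (T x0) (S m x0)) \<le> nrm X (x m - x0)" .
    have "re_part (D (v m) (S m (x m)) - D (T x0) (S m x0))
        \<le> nrm (dual Y) (D (v m) - D (T x0)) + nrm X (x m - x0)"
      using re_part_le[of "D (v m) (S m (x m)) - D (T x0) (S m x0)"] 1 2
        norm_triangle_ineq[of "D (v m) (S m (x m)) - D (T x0) (S m (x m))"
          "D (T x0) (S m (x m)) - D (T x0) (S m x0)"] by simp
    with quot show ?case
      by (simp add: re_part_diff norming_functional_def Sc \<delta>_def flip: m_def)
  qed
  ultimately show ?thesis
    using that r x0 Tx0 unfolding U_def \<tau>_def by blast
qed

text \<open>
  With \<open>S\<^sub>n\<close> constant, the functional found in the preceding lemma dominates difference quotients for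
  arbitrarily small \<open>t\<close> up to a null sequence, and these dominate every functional of the duality map.
\<close>

lemma is_maximum_exists:
  assumes S: "S \<in> unit_ball B"
  shows "\<exists>m. is_maximum ((\<lambda>f. re_part (f S)) ` duality_map B T) m"
proof -
  have Sc: "S \<in> carr B"
    using S by (simp add: Bs.mem_unit_ball)
  obtain r x0 \<delta> where r: "strict_mono r" and x0: "x0 \<in> unit_ball X" "nrm Y (T x0) = nrm B T"
    and \<delta>: "\<delta> \<longlonglongrightarrow> 0"
    and le: "\<forall>\<^sub>F n in sequentially.
      (nrm B (T + scl B (of_real (inverse (real (Suc (r n))))) S) - nrm B T) / inverse (real (Suc (r n)))
       \<le> re_part (norming_functional x0 S) + \<delta> n"
    using quotient_subsequence[of "\<lambda>n. inverse (real (Suc n))" "\<lambda>n. S"] S LIMSEQ_inverse_real_of_nat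
    by auto
  have "re_part (f S) \<le> re_part (norming_functional x0 S)" if f: "f \<in> duality_map B T" for f
  proof (rule tendsto_lowerbound)
    show "(\<lambda>n. re_part (norming_functional x0 S) + \<delta> n) \<longlonglongrightarrow> re_part (norming_functional x0 S)"
      using tendsto_add[OF tendsto_const \<delta>] by simp
    show "\<forall>\<^sub>F n in sequentially. re_part (f S) \<le> re_part (norming_functional x0 S) + \<delta> n"
      using le
    proof eventually_elim
      case (elim n)
      have "0 < inverse (real (Suc (r n)))"
        by simp
      from re_part_duality_map_le_quotient[OF normed_carrier_ops f T Sc this] elim show ?case
        by linarith
    qed
  qed simp
  then show ?thesis
    using norming_functional_in_duality_map[OF x0] unfolding is_maximum_def by blast
qed

text \<open>
  If uniformity failed, there would be \<open>t\<^sub>n \<rightarrow> 0\<close> and \<open>S\<^sub>n\<close> whose difference quotients exceed the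
  maximum at \<open>S\<^sub>n\<close> by a fixed amount, contrary to \<open>quotient_subsequence\<close>.
\<close>

lemma op_in_SSD: "T \<in> SSD B"
proof -
  obtain M where M: "\<And>S. S \<in> unit_ball B \<Longrightarrow> is_maximum ((\<lambda>f. re_part (f S)) ` duality_map B T) (M S)"
    using is_maximum_exists by metis
  define quot where "quot t S = (nrm B (T + scl B (of_real t) S) - nrm B T) / t" for t S
  have lower: "M S \<le> quot t S" if S: "S \<in> unit_ball B" and t: "0 < t" for S t
  proof -
    obtain f where "f \<in> duality_map B T" "M S = re_part (f S)"
      using M[OF S] by (auto simp: is_maximum_def)
    with re_part_duality_map_le_quotient[OF normed_carrier_ops _ T _ t] S show ?thesis
      by (simp add: quot_def Bs.mem_unit_ball)
  qed
  have upper: "\<exists>d>0. \<forall>t S. 0 < t \<and> t < d \<and> S \<in> unit_ball B \<longrightarrow> quot t S < M S + e" if e: "0 < e" for e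
  proof (rule ccontr)
    assume neg: "\<not> ?thesis"
    have "\<exists>t S. 0 < t \<and> t < inverse (real (Suc n)) \<and> S \<in> unit_ball B \<and> M S + e \<le> quot t S" for n
    proof -
      have "0 < inverse (real (Suc n))" by simp
      with neg show ?thesis by (meson not_less)
    qed
    then obtain t S where tS: "\<And>n. 0 < t n" "\<And>n. t n < inverse (real (Suc n))"
        "\<And>n. S n \<in> unit_ball B" "\<And>n. M (S n) + e \<le> quot (t n) (S n)"
      by metis
    have "t \<longlonglongrightarrow> 0"
      by (rule tendsto_sandwich[OF _ _ tendsto_const LIMSEQ_inverse_real_of_nat])
        (use tS in \<open>auto intro!: always_eventually less_imp_le\<close>)
    obtain r x0 \<delta> where r: "strict_mono r" and x0: "x0 \<in> unit_ball X" "nrm Y (T x0) = nrm B T"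
      and \<delta>: "\<delta> \<longlonglongrightarrow> 0"
      and le: "\<forall>\<^sub>F n in sequentially. quot (t (r n)) (S (r n)) \<le> re_part (norming_functional x0 (S (r n))) + \<delta> n"
      using quotient_subsequence[of t S thesis, OF tS(1) \<open>t \<longlonglongrightarrow> 0\<close> tS(3)] unfolding quot_def .
    have "\<forall>\<^sub>F n in sequentially. \<delta> n < e"
      using \<delta> e by (rule order_tendstoD)
    with le have "\<forall>\<^sub>F n in sequentially. False"
    proof eventually_elim
      case (elim n)
      have "re_part (norming_functional x0 (S (r n))) \<le> M (S (r n))"
        using M[OF tS(3), of "r n"] norming_functional_in_duality_map[OF x0] by (auto simp: is_maximum_def)
      with elim tS(4)[of "r n"] show False by linarith
    qed
    then show False by simp
  qed
  have "uniform_limit (unit_ball B) quot M (at_right 0)"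
  proof (rule uniform_limitI)
    fix e :: real assume "0 < e"
    then obtain d where d: "0 < d" "\<forall>t S. 0 < t \<and> t < d \<and> S \<in> unit_ball B \<longrightarrow> quot t S < M S + e"
      using upper[of e] by auto
    have "\<forall>\<^sub>F t in at_right (0::real). 0 < t \<and> t < d"
      using d(1) unfolding eventually_at_right_field by blast
    then show "\<forall>\<^sub>F t in at_right 0. \<forall>S\<in>unit_ball B. dist (quot t S) (M S) < e"
    proof eventually_elim
      case (elim t)
      show ?case
      proof
        fix S assume "S \<in> unit_ball B"
        then show "dist (quot t S) (M S) < e"
          using elim d(2)[rule_format, of t S] lower[of S t] by (simp add: dist_real_def)
      qed
    qed
  qed
  then have "ssd_at B T"
    unfolding ssd_at_def quot_def using M by blast
  then show ?thesis
    using T by (simp add: SSD_def)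
qed

end

section \<open>The sequence spaces\<close>

subsection \<open>Elementary inequalities\<close>

lemma powr_convex_combination:
  fixes a b l p :: real
  assumes p: "1 \<le> p" and ab: "0 \<le> a" "0 \<le> b" and l: "0 < l" "l < 1"
  shows "((1 - l) * a + l * b) powr p \<le> (1 - l) * a powr p + l * b powr p"
proof -
  have le: "(m * c) powr p \<le> m * c powr p" if "0 < m" "m < 1" "0 \<le> c" for m c :: real
  proof -
    have "m powr p \<le> m powr 1"
      using that p by (intro powr_mono') auto
    then show ?thesis
      using that by (simp add: powr_mult mult_right_mono)
  qed
  consider "a = 0" | "b = 0" | "0 < a" "0 < b"
    using ab by linarith
  then show ?thesis
  proof cases
    case 1
    then show ?thesis using le[of l b] l ab by simp
  next
    case 2
    then show ?thesis using le[of "1 - l" a] l ab by simp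
  next
    case 3
    then show ?thesis
      using convex_onD[OF powr_convex[OF p], of l a b] l by simp
  qed
qed

text \<open>
  Write \<open>a + b\<close> as a convex combination of \<open>a / (1 - l)\<close> and \<open>b / l\<close>. A fixed weight shows that sums stay
  in \<open>\<ell>\<^sub>p\<close>, the weight proportional to the norms gives Minkowski's inequality, and a weight close to zero
  gives the perturbation bound that follows.
\<close>

lemma powr_add_le_weighted:
  fixes a b l p :: real
  assumes p: "1 \<le> p" and ab: "0 \<le> a" "0 \<le> b" and l: "0 < l" "l < 1"
  shows "(a + b) powr p \<le> (1 - l) powr (1 - p) * a powr p + l powr (1 - p) * b powr p"
proof -
  have scale: "m * (c / m) powr p = m powr (1 - p) * c powr p" if "0 < m" "0 \<le> c" for m c :: real
    using that by (simp add: powr_divide powr_diff)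
  have "(a + b) powr p = ((1 - l) * (a / (1 - l)) + l * (b / l)) powr p"
    using l by simp
  also have "\<dots> \<le> (1 - l) * (a / (1 - l)) powr p + l * (b / l) powr p"
    using powr_convex_combination[OF p, of "a / (1 - l)" "b / l" l] ab l by simp
  finally show ?thesis
    using scale[of "1 - l" a] scale[of l b] ab l by simp
qed

text \<open>
  A perturbation of \<open>u\<close> by at most \<open>w\<close> changes the power by an arbitrarily small multiple of \<open>u\<^sup>p\<close>, at
  the price of a large multiple of \<open>w\<^sup>p\<close>. In \<open>Brezis_Lieb\<close>, \<open>u\<close> belongs to the bounded sequence and \<open>w\<close> to a
  fixed summable one.
\<close>

lemma powr_difference_bound:
  fixes p \<epsilon> :: real
  assumes p: "1 < p" and \<epsilon>: "0 < \<epsilon>"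
  obtains K where "0 \<le> K"
    "\<And>s u w. 0 \<le> s \<Longrightarrow> 0 \<le> u \<Longrightarrow> 0 \<le> w \<Longrightarrow> \<bar>s - u\<bar> \<le> w \<Longrightarrow>
       \<bar>s powr p - u powr p\<bar> \<le> \<epsilon> * u powr p + K * w powr p"
proof -
  \<comment> \<open>The weight \<open>m\<close> of \<open>u\<close> solves \<open>m\<^bsup>1-p\<^esup> = 1 + \<epsilon>\<close>.\<close>
  define m where "m = (1 + \<epsilon>) powr (- 1 / (p - 1))"
  have "m < (1 + \<epsilon>) powr 0"
    unfolding m_def using p \<epsilon> by (intro powr_less_mono) (auto simp: field_simps)
  then have m: "0 < m" "m < 1"
    using \<epsilon> by (auto simp: m_def)
  have "- 1 / (p - 1) * (1 - p) = 1"
    using p by (simp add: field_simps)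
  then have mp: "m powr (1 - p) = 1 + \<epsilon>"
    using \<epsilon> unfolding m_def powr_powr by simp
  define K where "K = (1 - m) powr (1 - p)"
  have add: "s powr p \<le> (1 + \<epsilon>) * u powr p + K * w powr p"
    if "0 \<le> s" "0 \<le> u" "0 \<le> w" "s \<le> u + w" for s u w
  proof -
    have "s powr p \<le> (u + w) powr p"
      using that p by (intro powr_mono2) auto
    also have "\<dots> \<le> (1 + \<epsilon>) * u powr p + K * w powr p"
      using powr_add_le_weighted[of p u w "1 - m"] that m p by (simp add: mp K_def)
    finally show ?thesis .
  qed
  have "\<bar>s powr p - u powr p\<bar> \<le> \<epsilon> * u powr p + K * w powr p"
    if h: "0 \<le> s" "0 \<le> u" "0 \<le> w" "\<bar>s - u\<bar> \<le> w" for s u w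
  proof (cases "s \<le> u")
    case True
    then have "s powr p \<le> u powr p"
      using h p by (intro powr_mono2) auto
    moreover from this have "\<epsilon> * s powr p \<le> \<epsilon> * u powr p"
      using \<epsilon> by simp
    moreover have "u powr p \<le> (1 + \<epsilon>) * s powr p + K * w powr p"
      using h by (intro add) auto
    ultimately show ?thesis by (simp add: algebra_simps)
  next
    case False
    then have "u powr p \<le> s powr p"
      using h p by (intro powr_mono2) auto
    moreover have "s powr p \<le> (1 + \<epsilon>) * u powr p + K * w powr p"
      using h by (intro add) auto
    ultimately show ?thesis by (simp add: algebra_simps)
  qed
  then show ?thesis
    using that[of K] by (simp add: K_def)
qed

text \<open>
  Dominated convergence, where the dominating function may contain a small multiple of terms whose sums
  are merely bounded. The part of \<open>g\<close> that exceeds this multiple is dominated by \<open>h\<close>, so its sum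
  vanishes in the limit by Tannery's theorem; the rest contributes at most \<open>\<epsilon> C\<close>.
\<close>

lemma suminf_tendsto_0_of_dominated:
  fixes g b :: "nat \<Rightarrow> nat \<Rightarrow> real"
  assumes g_nonneg: "\<And>n k. 0 \<le> g n k" and g_lim: "\<And>k. (\<lambda>n. g n k) \<longlonglongrightarrow> 0"
    and b: "\<And>n. summable (b n)" "\<And>n. suminf (b n) \<le> C" "\<And>n k. 0 \<le> b n k"
    and dom: "\<And>\<epsilon>. 0 < \<epsilon> \<Longrightarrow> \<exists>h. summable h \<and> (\<forall>k. 0 \<le> h k) \<and> (\<forall>n k. g n k \<le> \<epsilon> * b n k + h k)"
  shows "\<And>n. summable (g n)" and "(\<lambda>n. suminf (g n)) \<longlonglongrightarrow> 0"
proof -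
  show sg: "summable (g n)" for n
  proof -
    obtain h where h: "summable h" "\<And>n k. g n k \<le> 1 * b n k + h k"
      using dom[of 1] by auto
    have "summable (\<lambda>k. 1 * b n k + h k)"
      using b(1)[of n] h(1) by (simp add: summable_add)
    then show ?thesis
      by (rule summable_comparison_test') (use h g_nonneg in auto)
  qed
  have C: "0 \<le> C"
    using suminf_nonneg[OF b(1) b(3), of 0] b(2)[of 0] by linarith
  show "(\<lambda>n. suminf (g n)) \<longlonglongrightarrow> 0"
  proof (rule order_tendstoI)
    fix a :: real assume "a < 0"
    then show "\<forall>\<^sub>F n in sequentially. a < suminf (g n)"
      using suminf_nonneg[OF sg g_nonneg] by (intro always_eventually) (auto intro: less_le_trans)
  next
    fix e :: real assume e: "0 < e"
    define \<epsilon> where "\<epsilon> = e / (2 * (C + 1))"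
    have \<epsilon>: "0 < \<epsilon>" "\<epsilon> * C \<le> e / 2"
      using e C by (auto simp: \<epsilon>_def field_simps)
    obtain h where h: "summable h" "\<And>k. 0 \<le> h k" "\<And>n k. g n k \<le> \<epsilon> * b n k + h k"
      using dom[OF \<epsilon>(1)] by auto
    define W where "W k n = max 0 (g n k - \<epsilon> * b n k)" for k n
    have W_le: "norm (W k n) \<le> g n k" "norm (W k n) \<le> h k" for k n
      using g_nonneg[of n k] b(3)[of n k] \<epsilon>(1) h(2)[of k] h(3)[of n k] by (auto simp: W_def)
    have sW: "summable (\<lambda>k. W k n)" for n
      using sg[of n] by (rule summable_comparison_test') (use W_le in auto)
    have "(\<lambda>n. \<Sum>k. W k n) \<longlonglongrightarrow> (\<Sum>k. 0)"
    proof (rule tannerys_theorem[where M = h, THEN conjunct2, THEN conjunct2])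
      show "(\<lambda>n. W k n) \<longlonglongrightarrow> 0" for k
        by (rule Lim_null_comparison[OF always_eventually g_lim[of k]]) (use W_le in auto)
      show "\<forall>\<^sub>F (k, n) in at_top \<times>\<^sub>F sequentially. norm (W k n) \<le> h k"
        using W_le by (intro always_eventually) auto
    qed (use h in auto)
    then have "(\<lambda>n. \<Sum>k. W k n) \<longlonglongrightarrow> 0"
      by simp
    then have "\<forall>\<^sub>F n in sequentially. (\<Sum>k. W k n) < e / 2"
      using e by (intro order_tendstoD) auto
    then show "\<forall>\<^sub>F n in sequentially. suminf (g n) < e"
    proof eventually_elim
      case (elim n)
      have "suminf (g n) \<le> (\<Sum>k. W k n + \<epsilon> * b n k)"
        using sg sW b(1) by (intro suminf_le summable_add summable_mult) (auto simp: W_def)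
      also have "\<dots> = (\<Sum>k. W k n) + \<epsilon> * suminf (b n)"
        using sW b(1) by (simp add: suminf_add[symmetric] suminf_mult summable_mult)
      also have "\<dots> \<le> (\<Sum>k. W k n) + \<epsilon> * C"
        using b(2)[of n] \<epsilon>(1) by simp
      finally show ?case
        using elim \<epsilon>(2) by linarith
    qed
  qed
qed

subsection \<open>The norm\<close>

definition psum :: "real \<Rightarrow> (nat \<Rightarrow> 'k::real_normed_field) \<Rightarrow> real" where
  "psum p x = (\<Sum>n. norm (x n) powr p)"

lemma carr_ell: "x \<in> carr (ell p) \<longleftrightarrow> summable (\<lambda>n. norm (x n) powr p)"
  by (simp add: ell_def)

lemma nrm_ell: "nrm (ell p) x = psum p x powr (1 / p)"
  by (simp add: ell_def psum_def)

lemma scl_ell: "scl (ell p) c x = (\<lambda>n. c * x n)"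
  by (simp add: ell_def)

lemma psum_nonneg: "x \<in> carr (ell p) \<Longrightarrow> 0 \<le> psum p x"
  by (simp add: psum_def carr_ell suminf_nonneg)

lemma nrm_ell_nonneg [simp]: "0 \<le> nrm (ell p) x"
  by (simp add: nrm_ell)

lemma nrm_ell_powr:
  assumes "0 < p" "x \<in> carr (ell p)"
  shows "nrm (ell p) x powr p = psum p x"
  using assms by (simp add: nrm_ell powr_powr psum_nonneg)

lemma nrm_ell_le_iff:
  assumes "0 < p" "x \<in> carr (ell p)" "0 \<le> c"
  shows "nrm (ell p) x \<le> c \<longleftrightarrow> psum p x \<le> c powr p"
  using assms powr_mono2[of p "nrm (ell p) x" c] powr_less_mono2[of p c "nrm (ell p) x"]
  by (auto simp: nrm_ell_powr not_le[symmetric] simp flip: nrm_ell_powr)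

lemma sum_le_psum:
  "x \<in> carr (ell p) \<Longrightarrow> finite A \<Longrightarrow> (\<Sum>k\<in>A. norm (x k) powr p) \<le> psum p x"
  unfolding psum_def carr_ell by (rule sum_le_suminf) auto

lemma norm_le_nrm_ell:
  assumes "0 < p" "x \<in> carr (ell p)"
  shows "norm (x k) \<le> nrm (ell p) x"
proof -
  have "norm (x k) powr p \<le> nrm (ell p) x powr p"
    using sum_le_psum[OF assms(2), of "{k}"] assms by (simp add: nrm_ell_powr)
  then show ?thesis
    using assms(1) powr_less_mono2[of p "nrm (ell p) x" "norm (x k)"] by (simp add: not_le[symmetric])
      (meson not_le)
qed

lemma psum_scl: "psum p (\<lambda>n. c * x n) = norm c powr p * psum p x" if "x \<in> carr (ell p)"
  using that by (simp add: psum_def norm_mult powr_mult suminf_mult carr_ell)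

text \<open>
  In the triangle inequality, with \<open>a = \<parallel>x\<parallel>\<close> and \<open>b = \<parallel>y\<parallel>\<close>, the weight \<open>b / (a + b)\<close> makes the two terms
  of the weighted bound add up to exactly \<open>(a + b)\<^sup>p\<close>.
\<close>

lemma normed_carrier_ell:
  assumes p: "1 \<le> p"
  shows "normed_carrier (ell p :: ('k::real_normed_field, nat \<Rightarrow> 'k) nspace)"
proof
  let ?X = "ell p :: ('k, nat \<Rightarrow> 'k) nspace"
  show "0 \<in> carr ?X"
    using p by (simp add: carr_ell)
  have sm: "summable (\<lambda>n. norm (x n + y n) powr p)"
    and le: "0 < l \<Longrightarrow> l < 1 \<Longrightarrow>
      psum p (x + y) \<le> (1 - l) powr (1 - p) * psum p x + l powr (1 - p) * psum p y"
    if xy: "x \<in> carr ?X" "y \<in> carr ?X" for x y l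
  proof -
    have pt: "norm (x n + y n) powr p
        \<le> (1 - l) powr (1 - p) * norm (x n) powr p + l powr (1 - p) * norm (y n) powr p"
      if "0 < l" "l < 1" for n l
    proof -
      have "norm (x n + y n) powr p \<le> (norm (x n) + norm (y n)) powr p"
        using p by (intro powr_mono2 norm_triangle_ineq) auto
      then show ?thesis
        using powr_add_le_weighted[OF p, of "norm (x n)" "norm (y n)" l] that by simp
    qed
    have s: "summable (\<lambda>n. (1 - l) powr (1 - p) * norm (x n) powr p + l powr (1 - p) * norm (y n) powr p)" for l
      using xy by (intro summable_add summable_mult) (auto simp: carr_ell)
    show sm: "summable (\<lambda>n. norm (x n + y n) powr p)"
      by (rule summable_comparison_test'[OF s[of "1/2"]]) (use pt[of "1/2"] in auto)
    assume l: "0 < l" "l < 1"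
    have "psum p (x + y) \<le> (\<Sum>n. (1 - l) powr (1 - p) * norm (x n) powr p + l powr (1 - p) * norm (y n) powr p)"
      unfolding psum_def plus_fun_apply by (intro suminf_le pt l sm s)
    also have "\<dots> = (1 - l) powr (1 - p) * psum p x + l powr (1 - p) * psum p y"
      using xy by (simp add: psum_def carr_ell suminf_add[symmetric] suminf_mult summable_mult)
    finally show "psum p (x + y) \<le> (1 - l) powr (1 - p) * psum p x + l powr (1 - p) * psum p y" .
  qed
  show add: "x + y \<in> carr ?X" if "x \<in> carr ?X" "y \<in> carr ?X" for x y
    using sm[OF that] by (simp add: carr_ell)
  show "scl ?X c x \<in> carr ?X" if "x \<in> carr ?X" for c x
    using that by (simp add: carr_ell scl_ell norm_mult powr_mult summable_mult)
  show "nrm ?X (scl ?X c x) = norm c * nrm ?X x" if "x \<in> carr ?X" for c x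
    using that p by (simp add: nrm_ell scl_ell psum_scl powr_mult psum_nonneg powr_powr)
  show eq0: "x = 0" if "x \<in> carr ?X" "nrm ?X x = 0" for x
    using norm_le_nrm_ell[OF _ that(1)] that(2) p by (auto simp: fun_eq_iff)
  show "nrm ?X (x + y) \<le> nrm ?X x + nrm ?X y" if xy: "x \<in> carr ?X" "y \<in> carr ?X" for x y
  proof -
    define a where "a = nrm ?X x"
    define b where "b = nrm ?X y"
    consider "x = 0" | "y = 0" | "0 < a" "0 < b"
      using eq0[OF xy(1)] eq0[OF xy(2)] nrm_ell_nonneg[of p x] nrm_ell_nonneg[of p y]
      unfolding a_def b_def by (metis less_eq_real_def)
    then show ?thesis
    proof cases
      case 3
      have ratio: "(c / (a + b)) powr (1 - p) * c powr p = c * (a + b) powr (p - 1)" if "0 < c" for c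
        using that 3 by (simp add: powr_divide powr_diff)
      have "psum p (x + y) \<le> (1 - b / (a + b)) powr (1 - p) * psum p x + (b / (a + b)) powr (1 - p) * psum p y"
        using le[OF xy, of "b / (a + b)"] 3 by simp
      also have "1 - b / (a + b) = a / (a + b)"
        using 3 by (simp add: field_simps)
      also have "psum p x = a powr p"
        using xy p by (simp add: a_def nrm_ell_powr)
      also have "psum p y = b powr p"
        using xy p by (simp add: b_def nrm_ell_powr)
      also have "(a / (a + b)) powr (1 - p) * a powr p + (b / (a + b)) powr (1 - p) * b powr p = (a + b) powr p"
        using 3 powr_mult_base[of "a + b" "p - 1"] unfolding ratio[OF 3(1)] ratio[OF 3(2)]
        by (simp flip: distrib_right)
      finally show ?thesis
        using nrm_ell_le_iff[of p "x + y" "a + b"] add[OF xy] p 3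
        by (simp add: a_def b_def plus_fun_def)
    qed simp_all
  qed
qed (simp_all add: scl_ell plus_fun_def distrib_left distrib_right mult.assoc)

subsection \<open>Pointwise convergence\<close>

lemma tendsto_norm_powr:
  assumes "0 < p" "(f \<longlongrightarrow> a) F"
  shows "((\<lambda>n. norm (f n) powr p) \<longlongrightarrow> norm a powr p) F"
  using assms by (intro tendsto_powr' tendsto_norm tendsto_const) auto

text \<open>
  Where \<open>x\<close> carries its mass, \<open>z\<^sub>n\<close> is eventually small; elsewhere \<open>x\<close> is negligible. Thus \<open>x\<close> and \<open>z\<^sub>n\<close>
  become disjoint in the limit and the powers of their norms add.
\<close>

lemma Brezis_Lieb:
  fixes x :: "nat \<Rightarrow> 'k::real_normed_field"
  assumes p: "1 < p" and x: "x \<in> carr (ell p)" and z: "\<And>n. z n \<in> carr (ell p)"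
    and C: "\<And>n. psum p (z n) \<le> C" and lim: "\<And>k. (\<lambda>n. z n k) \<longlonglongrightarrow> 0"
  shows "(\<lambda>n. psum p (x + z n) - psum p (z n)) \<longlonglongrightarrow> psum p x"
proof -
  interpret normed_carrier "ell p :: ('k, nat \<Rightarrow> 'k) nspace"
    using p by (intro normed_carrier_ell) simp
  define g where "g n k = \<bar>norm (x k + z n k) powr p - norm (z n k) powr p - norm (x k) powr p\<bar>" for n k
  have g: "\<And>n. summable (g n)" "(\<lambda>n. suminf (g n)) \<longlonglongrightarrow> 0"
  proof (atomize(full), intro conjI allI)
    have g_lim: "(\<lambda>n. g n k) \<longlonglongrightarrow> 0" for k
    proof -
      have "(\<lambda>n. norm (x k + z n k) powr p - norm (z n k) powr p - norm (x k) powr p)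
          \<longlonglongrightarrow> norm (x k + 0) powr p - norm (0 :: 'k) powr p - norm (x k) powr p"
        using p by (intro tendsto_diff tendsto_norm_powr tendsto_add tendsto_const lim) auto
      then show ?thesis
        unfolding g_def using p by (intro tendsto_rabs_zero) simp
    qed
    have dom: "\<exists>h. summable h \<and> (\<forall>k. 0 \<le> h k) \<and> (\<forall>n k. g n k \<le> \<epsilon> * norm (z n k) powr p + h k)"
      if \<epsilon>: "0 < \<epsilon>" for \<epsilon>
    proof -
      obtain K where K: "0 \<le> K"
        "\<And>s u w. 0 \<le> s \<Longrightarrow> 0 \<le> u \<Longrightarrow> 0 \<le> w \<Longrightarrow> \<bar>s - u\<bar> \<le> w \<Longrightarrow>
           \<bar>s powr p - u powr p\<bar> \<le> \<epsilon> * u powr p + K * w powr p"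
        using powr_difference_bound[OF p \<epsilon>] by blast
      have "g n k \<le> \<epsilon> * norm (z n k) powr p + (K + 1) * norm (x k) powr p" for n k
      proof -
        have "\<bar>norm (x k + z n k) - norm (z n k)\<bar> \<le> norm (x k)"
          using norm_triangle_ineq3[of "x k + z n k" "z n k"] by simp
        then have "\<bar>norm (x k + z n k) powr p - norm (z n k) powr p\<bar>
            \<le> \<epsilon> * norm (z n k) powr p + K * norm (x k) powr p"
          by (intro K(2)) auto
        then show ?thesis
          unfolding g_def distrib_right using powr_ge_zero[of "norm (x k)" p] by linarith
      qed
      moreover have "summable (\<lambda>k. (K + 1) * norm (x k) powr p)"
        using x by (intro summable_mult) (simp add: carr_ell)
      ultimately show ?thesis
        using K(1) by (intro exI[of _ "\<lambda>k. (K + 1) * norm (x k) powr p"]) auto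
    qed
    note * = suminf_tendsto_0_of_dominated[of g "\<lambda>n k. norm (z n k) powr p" C, OF _ g_lim _ _ _ dom]
    show "summable (g n)" for n
      using z C by (intro *(1)) (auto simp: g_def carr_ell psum_def)
    show "(\<lambda>n. suminf (g n)) \<longlonglongrightarrow> 0"
      using z C by (intro *(2)) (auto simp: g_def carr_ell psum_def)
  qed
  have "\<bar>psum p (x + z n) - psum p (z n) - psum p x\<bar> \<le> suminf (g n)" for n
  proof -
    have s: "summable (\<lambda>k. norm (x k + z n k) powr p)" "summable (\<lambda>k. norm (z n k) powr p)"
        "summable (\<lambda>k. norm (x k) powr p)"
      using add_closed[OF x z, of n] x z[of n] by (auto simp: carr_ell)
    have "psum p (x + z n) - psum p (z n) - psum p x
        = (\<Sum>k. norm (x k + z n k) powr p - norm (z n k) powr p - norm (x k) powr p)"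
      using s by (simp add: psum_def suminf_diff summable_diff)
    also have "\<bar>\<dots>\<bar> \<le> suminf (g n)"
      using g(1)[of n] unfolding g_def by (rule summable_rabs)
    finally show ?thesis .
  qed
  then have "(\<lambda>n. psum p (x + z n) - psum p (z n) - psum p x) \<longlonglongrightarrow> 0"
    by (intro Lim_null_comparison[OF always_eventually g(2)]) auto
  then show ?thesis
    by (simp add: LIM_zero_iff)
qed

text \<open>Fatou's lemma for series, by looking at finite partial sums.\<close>

lemma ell_pointwise_limit:
  assumes p: "0 < p" and x: "\<And>n. x n \<in> carr (ell p)" and C: "\<And>n. psum p (x n) \<le> C"
    and lim: "\<And>k. (\<lambda>n. x n k) \<longlonglongrightarrow> y k"
  shows "y \<in> carr (ell p)" and "psum p y \<le> C"
proof -
  have fin: "(\<Sum>k<m. norm (y k) powr p) \<le> C" for m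
  proof (rule tendsto_upperbound)
    show "(\<lambda>n. \<Sum>k<m. norm (x n k) powr p) \<longlonglongrightarrow> (\<Sum>k<m. norm (y k) powr p)"
      by (intro tendsto_sum tendsto_norm_powr p lim)
    show "\<forall>\<^sub>F n in sequentially. (\<Sum>k<m. norm (x n k) powr p) \<le> C"
      using sum_le_psum[OF x, of "{..<m}"] C by (intro always_eventually) (auto intro: order_trans)
  qed simp
  then have s: "summable (\<lambda>k. norm (y k) powr p)"
    by (intro summableI_nonneg_bounded) auto
  then show "y \<in> carr (ell p)"
    by (simp add: carr_ell)
  show "psum p y \<le> C"
    unfolding psum_def using s fin by (rule suminf_le_const)
qed

lemma tendsto_nrm_ell_zero_iff:
  assumes p: "0 < p" and x: "\<And>n. x n \<in> carr (ell p)"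
  shows "((\<lambda>n. nrm (ell p) (x n)) \<longlongrightarrow> 0) F \<longleftrightarrow> ((\<lambda>n. psum p (x n)) \<longlongrightarrow> 0) F"
proof
  assume "((\<lambda>n. nrm (ell p) (x n)) \<longlongrightarrow> 0) F"
  then have "((\<lambda>n. nrm (ell p) (x n) powr p) \<longlongrightarrow> 0 powr p) F"
    using p by (intro tendsto_powr') auto
  then show "((\<lambda>n. psum p (x n)) \<longlongrightarrow> 0) F"
    using p x by (simp add: nrm_ell_powr)
next
  assume "((\<lambda>n. psum p (x n)) \<longlongrightarrow> 0) F"
  then have "((\<lambda>n. psum p (x n) powr (1 / p)) \<longlongrightarrow> 0 powr (1 / p)) F"
    using p x by (intro tendsto_powr') (auto simp: psum_nonneg)
  then show "((\<lambda>n. nrm (ell p) (x n)) \<longlongrightarrow> 0) F"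
    by (simp add: nrm_ell)
qed

text \<open>
  By \<open>Brezis_Lieb\<close> the power of the norm of \<open>x\<^sub>n - y\<close> is asymptotically the difference of those of \<open>x\<^sub>n\<close>
  and \<open>y\<close>.
\<close>

lemma Radon_Riesz:
  fixes y :: "nat \<Rightarrow> 'k::real_normed_field"
  assumes p: "1 < p" and x: "\<And>n. x n \<in> carr (ell p)" and y: "y \<in> carr (ell p)"
    and lim: "\<And>k. (\<lambda>n. x n k) \<longlonglongrightarrow> y k" and psum: "(\<lambda>n. psum p (x n)) \<longlonglongrightarrow> psum p y"
  shows "(\<lambda>n. nrm (ell p) (x n - y)) \<longlonglongrightarrow> 0"
proof -
  interpret normed_carrier "ell p :: ('k, nat \<Rightarrow> 'k) nspace"
    using p by (intro normed_carrier_ell) simp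
  have "Bseq (\<lambda>n. psum p (x n))"
    using psum by (intro convergent_imp_Bseq) (auto simp: convergent_def)
  then obtain K where K: "0 < K" "\<And>n. psum p (x n) \<le> K"
    by (auto simp: Bseq_def abs_le_iff)
  have nx: "nrm (ell p) (x n) \<le> K powr (1 / p)" for n
    using K p x[of n] by (simp add: nrm_ell_le_iff powr_powr)
  define c where "c = K powr (1 / p) + nrm (ell p) y"
  have bound: "psum p (x n - y) \<le> c powr p" for n
  proof -
    have "nrm (ell p) (x n - y) \<le> c"
      using nrm_triangle[of "x n" "- y"] x y nx[of n] by (simp add: c_def)
    moreover have "0 \<le> c"
      by (simp add: c_def)
    ultimately show ?thesis
      using p x y nrm_ell_le_iff[of p "x n - y" c] by simp
  qed
  have "(\<lambda>n. psum p (y + (x n - y)) - psum p (x n - y)) \<longlonglongrightarrow> psum p y"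
  proof (rule Brezis_Lieb[OF p y _ bound])
    show "(\<lambda>n. (x n - y) k) \<longlonglongrightarrow> 0" for k
      using lim[of k] by (simp add: LIM_zero_iff)
  qed (use x y in simp)
  then have "(\<lambda>n. psum p (x n) - psum p (x n - y)) \<longlonglongrightarrow> psum p y"
    by simp
  from tendsto_diff[OF psum this] have "(\<lambda>n. psum p (x n - y)) \<longlonglongrightarrow> 0"
    by simp
  then show ?thesis
    using p x y by (subst tendsto_nrm_ell_zero_iff) auto
qed

section \<open>Duality of sequence spaces\<close>

definition conj_exp :: "real \<Rightarrow> real" where
  "conj_exp p = p / (p - 1)"

lemma conj_exp_gt_1: "1 < p \<Longrightarrow> 1 < conj_exp p"
  by (simp add: conj_exp_def field_simps)

lemma conj_exp_sum: "1 < p \<Longrightarrow> 1 / conj_exp p + 1 / p = 1"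
  by (simp add: conj_exp_def field_simps)

lemma conj_exp_conj_exp: "1 < p \<Longrightarrow> conj_exp (conj_exp p) = p"
  by (simp add: conj_exp_def field_simps)

lemma conj_exp_mult: "1 < p \<Longrightarrow> (p - 1) * conj_exp p = p"
  by (simp add: conj_exp_def)

text \<open>
  The value off the carrier is zero because functionals are represented in this way.
\<close>

definition pairing :: "real \<Rightarrow> (nat \<Rightarrow> 'k::real_normed_field) \<Rightarrow> (nat \<Rightarrow> 'k) \<Rightarrow> 'k" where
  "pairing p a = (\<lambda>x. if x \<in> carr (ell p) then \<Sum>k. a k * x k else 0)"

lemma Hoelder:
  fixes a x :: "nat \<Rightarrow> 'k::real_normed_field"
  assumes p: "1 < p" and a: "a \<in> carr (ell (conj_exp p))" and x: "x \<in> carr (ell p)"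
  shows "summable (\<lambda>k. norm (a k * x k))"
    and "(\<Sum>k. norm (a k * x k)) \<le> nrm (ell (conj_exp p)) a * nrm (ell p) x"
proof -
  let ?q = "conj_exp p"
  interpret A: normed_carrier "ell ?q :: ('k, nat \<Rightarrow> 'k) nspace"
    using conj_exp_gt_1[OF p] by (intro normed_carrier_ell) simp
  interpret X: normed_carrier "ell p :: ('k, nat \<Rightarrow> 'k) nspace"
    using p by (intro normed_carrier_ell) simp
  have "summable (\<lambda>k. norm (a k * x k)) \<and>
      (\<Sum>k. norm (a k * x k)) \<le> nrm (ell ?q) a * nrm (ell p) x"
  proof (cases "a = 0 \<or> x = 0")
    case True
    then show ?thesis by auto
  next
    case False
    define \<alpha> where "\<alpha> = nrm (ell ?q) a"
    define \<xi> where "\<xi> = nrm (ell p) x"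
    have pos: "0 < \<alpha>" "0 < \<xi>"
      using False A.nrm_eq_0[OF a] X.nrm_eq_0[OF x] by (auto simp: \<alpha>_def \<xi>_def less_le)
    have sums: "psum ?q a = \<alpha> powr ?q" "psum p x = \<xi> powr p"
      using a x p conj_exp_gt_1[OF p] by (simp_all add: \<alpha>_def \<xi>_def nrm_ell_powr)
    define h where "h k = \<alpha> * \<xi> * (norm (a k) powr ?q / (\<alpha> powr ?q * ?q) + norm (x k) powr p / (\<xi> powr p * p))" for k
    have le: "norm (a k * x k) \<le> h k" for k
    proof -
      have "norm (a k) / \<alpha> * (norm (x k) / \<xi>)
          \<le> (norm (a k) / \<alpha>) powr ?q / ?q + (norm (x k) / \<xi>) powr p / p"
        using p pos conj_exp_gt_1[OF p] conj_exp_sum[OF p] by (intro Youngs_inequality) auto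
      then have "\<alpha> * \<xi> * (norm (a k) / \<alpha> * (norm (x k) / \<xi>)) \<le> h k"
        using pos unfolding h_def by (intro mult_left_mono) (simp_all add: powr_divide)
      then show ?thesis
        using pos by (simp add: norm_mult)
    qed
    have sa: "summable (\<lambda>k. norm (a k) powr ?q / (\<alpha> powr ?q * ?q))"
      and sx: "summable (\<lambda>k. norm (x k) powr p / (\<xi> powr p * p))"
      using a x by (auto simp: carr_ell intro: summable_divide)
    have h: "summable h"
      unfolding h_def by (intro summable_mult summable_add sa sx)
    have s: "summable (\<lambda>k. norm (a k * x k))"
      by (rule summable_comparison_test'[OF h]) (use le in auto)
    have "(\<Sum>k. norm (a k * x k)) \<le> suminf h"
      by (intro suminf_le le s h)
    also have "\<dots> = \<alpha> * \<xi> * (psum ?q a / (\<alpha> powr ?q * ?q) + psum p x / (\<xi> powr p * p))"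
      using sa sx a x unfolding h_def psum_def carr_ell
      by (subst suminf_mult; simp add: suminf_add[symmetric] suminf_divide summable_add)
    also have "\<dots> = \<alpha> * \<xi> * (1 / ?q + 1 / p)"
      using pos by (simp add: sums)
    also have "\<dots> = \<alpha> * \<xi>"
      by (simp only: conj_exp_sum[OF p] mult_1_right)
    finally show ?thesis
      using s by (simp add: \<alpha>_def \<xi>_def)
  qed
  then show "summable (\<lambda>k. norm (a k * x k))"
    and "(\<Sum>k. norm (a k * x k)) \<le> nrm (ell ?q) a * nrm (ell p) x"
    by auto
qed

context
  fixes p :: real
  assumes p: "1 < p"
begin

lemma pairing_summable:
  fixes a x :: "nat \<Rightarrow> 'k::{real_normed_field, banach}"
  assumes "a \<in> carr (ell (conj_exp p))" "x \<in> carr (ell p)"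
  shows "summable (\<lambda>k. a k * x k)"
  using Hoelder(1)[OF p assms] by (rule summable_norm_cancel)

lemma norm_pairing_le:
  fixes a x :: "nat \<Rightarrow> 'k::{real_normed_field, banach}"
  assumes "a \<in> carr (ell (conj_exp p))" "x \<in> carr (ell p)"
  shows "norm (pairing p a x) \<le> nrm (ell (conj_exp p)) a * nrm (ell p) x"
  using summable_norm[OF Hoelder(1)[OF p assms]] Hoelder(2)[OF p assms] assms(2)
  by (simp add: pairing_def)

lemma pairing_closed:
  fixes a :: "nat \<Rightarrow> 'k::{real_normed_field, banach}"
  assumes a: "a \<in> carr (ell (conj_exp p))"
  shows "pairing p a \<in> carr (dual (ell p))"
proof -
  interpret X: normed_carrier "ell p :: ('k, nat \<Rightarrow> 'k) nspace"
    using p by (intro normed_carrier_ell) simp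
  interpret D: normed_carrier_pair "ell p :: ('k, nat \<Rightarrow> 'k) nspace" scalars
    by (rule X.normed_carrier_pair_dual)
  show ?thesis
    unfolding dual_def
  proof (rule D.opI[where C = "nrm (ell (conj_exp p)) a"])
    fix x y :: "nat \<Rightarrow> 'k" assume xy: "x \<in> carr (ell p)" "y \<in> carr (ell p)"
    show "pairing p a (x + y) = pairing p a x + pairing p a y"
      using xy pairing_summable[OF a xy(1)] pairing_summable[OF a xy(2)] X.add_closed[OF xy]
      by (simp add: pairing_def suminf_add distrib_left)
  next
    fix c :: 'k and x :: "nat \<Rightarrow> 'k" assume x: "x \<in> carr (ell p)"
    have "pairing p a (scl (ell p) c x) = (\<Sum>k. c * (a k * x k))"
      using X.scl_closed[OF x, of c] by (simp add: pairing_def scl_ell mult.left_commute)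
    also have "\<dots> = c * pairing p a x"
      using x pairing_summable[OF a x] by (simp add: pairing_def suminf_mult)
    finally show "pairing p a (scl (ell p) c x) = scl scalars c (pairing p a x)"
      by simp
  qed (use norm_pairing_le[OF a] in \<open>auto simp: pairing_def\<close>)
qed

lemma nrm_pairing_le:
  fixes a :: "nat \<Rightarrow> 'k::{real_normed_field, banach}"
  assumes a: "a \<in> carr (ell (conj_exp p))"
  shows "nrm (dual (ell p)) (pairing p a) \<le> nrm (ell (conj_exp p)) a"
proof -
  interpret X: normed_carrier "ell p :: ('k, nat \<Rightarrow> 'k) nspace"
    using p by (intro normed_carrier_ell) simp
  interpret D: normed_carrier_pair "ell p :: ('k, nat \<Rightarrow> 'k) nspace" scalars
    by (rule X.normed_carrier_pair_dual)
  show ?thesis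
    unfolding dual_def using norm_pairing_le[OF a] by (intro D.op_norm_le) auto
qed

lemma pairing_diff:
  fixes a b :: "nat \<Rightarrow> 'k::{real_normed_field, banach}"
  assumes "a \<in> carr (ell (conj_exp p))" "b \<in> carr (ell (conj_exp p))"
  shows "pairing p a - pairing p b = pairing p (a - b)"
  using pairing_summable[OF assms(1)] pairing_summable[OF assms(2)]
  by (auto simp: pairing_def fun_eq_iff suminf_diff left_diff_distrib)

text \<open>
  Young's inequality with a small factor at \<open>z\<^sub>n\<close> puts the terms in the situation of
  \<open>suminf_tendsto_0_of_dominated\<close>.
\<close>

lemma pairing_tendsto_0:
  fixes a :: "nat \<Rightarrow> 'k::{real_normed_field, banach}"
  assumes a: "a \<in> carr (ell (conj_exp p))" and z: "\<And>n. z n \<in> carr (ell p)"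
    and C: "\<And>n. psum p (z n) \<le> C" and lim: "\<And>k. (\<lambda>n. z n k) \<longlonglongrightarrow> 0"
  shows "(\<lambda>n. pairing p a (z n)) \<longlonglongrightarrow> 0"
proof -
  let ?q = "conj_exp p"
  have div_le: "y / c \<le> y" if "0 \<le> y" "1 < c" for y c :: real
    using that mult_left_mono[of 1 c y] by (simp add: divide_le_eq)
  have dom: "\<exists>h. summable h \<and> (\<forall>k. 0 \<le> h k) \<and>
      (\<forall>n k. norm (a k * z n k) \<le> \<epsilon> * norm (z n k) powr p + h k)" if \<epsilon>: "0 < \<epsilon>" for \<epsilon>
  proof -
    define s where "s = \<epsilon> powr (1 / p)"
    have s: "0 < s" "s powr p = \<epsilon>"
      using \<epsilon> p by (auto simp: s_def powr_powr)
    have "norm (a k * z n k) \<le> \<epsilon> * norm (z n k) powr p + norm (a k) powr ?q / s powr ?q" for n k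
    proof -
      have "norm (a k) / s * (s * norm (z n k)) \<le> (norm (a k) / s) powr ?q / ?q + (s * norm (z n k)) powr p / p"
        using p s conj_exp_gt_1[OF p] conj_exp_sum[OF p] by (intro Youngs_inequality) auto
      also have "\<dots> \<le> (norm (a k) / s) powr ?q + (s * norm (z n k)) powr p"
        using p conj_exp_gt_1[OF p] by (intro add_mono div_le) auto
      finally show ?thesis
        using s by (simp add: powr_divide powr_mult norm_mult)
    qed
    moreover have "summable (\<lambda>k. norm (a k) powr ?q / s powr ?q)"
      using a by (intro summable_divide) (simp add: carr_ell)
    ultimately show ?thesis
      by (intro exI[of _ "\<lambda>k. norm (a k) powr ?q / s powr ?q"]) auto
  qed
  have "(\<lambda>n. norm (a k * z n k)) \<longlonglongrightarrow> 0" for k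
    using tendsto_norm[OF tendsto_mult[OF tendsto_const lim[of k], of "a k"]] by simp
  from suminf_tendsto_0_of_dominated(2)[of "\<lambda>n k. norm (a k * z n k)" "\<lambda>n k. norm (z n k) powr p" C,
      OF _ this _ _ _ dom]
  have "(\<lambda>n. \<Sum>k. norm (a k * z n k)) \<longlonglongrightarrow> 0"
    using z C by (auto simp: carr_ell psum_def)
  then show ?thesis
    by (rule Lim_null_comparison[rotated])
      (use summable_norm[OF Hoelder(1)[OF p a z]] z in \<open>auto simp: pairing_def\<close>)
qed

end

subsection \<open>Truncations and unit vectors\<close>

definition trunc :: "(nat \<Rightarrow> 'k::real_normed_field) \<Rightarrow> nat \<Rightarrow> nat \<Rightarrow> 'k" where
  "trunc x m = (\<lambda>k. if k < m then x k else 0)"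

definition unit_seq :: "nat \<Rightarrow> nat \<Rightarrow> 'k::real_normed_field" where
  "unit_seq m = (\<lambda>k. if k = m then 1 else 0)"

lemma psum_trunc: "psum r (trunc x m) = (\<Sum>k<m. norm (x k) powr r)"
proof -
  have "psum r (trunc x m) = (\<Sum>k<m. norm (trunc x m k) powr r)"
    unfolding psum_def by (rule suminf_finite) (auto simp: trunc_def)
  then show ?thesis
    by (simp add: trunc_def)
qed

lemma trunc_closed: "trunc x m \<in> carr (ell r)"
  unfolding carr_ell by (rule summable_finite[of "{..<m}"]) (auto simp: trunc_def)

lemma unit_seq_closed: "unit_seq m \<in> carr (ell r)"
  unfolding carr_ell by (rule summable_finite[of "{m}"]) (auto simp: unit_seq_def)

lemma nrm_unit_seq: "nrm (ell r) (unit_seq m :: nat \<Rightarrow> 'k::real_normed_field) = 1"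
proof -
  have "psum r (unit_seq m :: nat \<Rightarrow> 'k) = (\<Sum>k\<in>{m}. norm (unit_seq m k :: 'k) powr r)"
    unfolding psum_def by (rule suminf_finite) (auto simp: unit_seq_def)
  then show ?thesis
    by (simp add: nrm_ell unit_seq_def)
qed

subsection \<open>The duality map\<close>

text \<open>
  The entry is \<open>\<bar>v\<^sub>k\<bar>\<^bsup>p-1\<^esup>\<close> times the conjugate of the sign of \<open>v\<^sub>k\<close>. Written as a quotient it needs
  no conjugation, and division by zero gives the right value for \<open>v\<^sub>k = 0\<close>.
\<close>

definition dual_seq :: "real \<Rightarrow> (nat \<Rightarrow> 'k::real_normed_field) \<Rightarrow> nat \<Rightarrow> 'k" where
  "dual_seq p v = (\<lambda>k. of_real (norm (v k) powr p) / v k)"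

text \<open>
  Normalising \<open>v\<close> before the sequence is formed makes the coefficient sequence a unit vector of the
  conjugate space. For \<open>v = 0\<close> the functional is zero.
\<close>

definition ell_duality :: "real \<Rightarrow> (nat \<Rightarrow> 'k::real_normed_field) \<Rightarrow> (nat \<Rightarrow> 'k) \<Rightarrow> 'k" where
  "ell_duality p v = pairing p (dual_seq p (scl (ell p) (of_real (1 / nrm (ell p) v)) v))"

lemma norm_dual_seq: "norm (dual_seq p v k) = norm (v k) powr (p - 1)"
  by (simp add: dual_seq_def norm_divide powr_diff)

lemma dual_seq_mult: "dual_seq p v k * v k = of_real (norm (v k) powr p)"
  by (simp add: dual_seq_def)

lemma norm_dual_seq_powr: "1 < p \<Longrightarrow> norm (dual_seq p v k) powr conj_exp p = norm (v k) powr p"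
  by (simp add: norm_dual_seq powr_powr conj_exp_mult)

lemma dual_seq_closed: "1 < p \<Longrightarrow> v \<in> carr (ell p) \<Longrightarrow> dual_seq p v \<in> carr (ell (conj_exp p))"
  by (simp add: carr_ell norm_dual_seq_powr)

lemma psum_dual_seq: "1 < p \<Longrightarrow> psum (conj_exp p) (dual_seq p v) = psum p v"
  by (simp add: psum_def norm_dual_seq_powr)

lemma tendsto_dual_seq:
  assumes p: "1 < p" and lim: "(\<lambda>n. v n k) \<longlonglongrightarrow> v0 k"
  shows "(\<lambda>n. dual_seq p (v n) k) \<longlonglongrightarrow> dual_seq p v0 k"
proof (cases "v0 k = 0")
  case True
  have "(\<lambda>n. norm (v n k) powr (p - 1)) \<longlonglongrightarrow> norm (v0 k) powr (p - 1)"
    using p lim by (intro tendsto_norm_powr) auto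
  then have "(\<lambda>n. norm (dual_seq p (v n) k)) \<longlonglongrightarrow> 0"
    using True by (simp add: norm_dual_seq)
  then show ?thesis
    using True by (simp add: dual_seq_def tendsto_norm_zero_iff)
next
  case False
  then show ?thesis
    unfolding dual_seq_def using p lim
    by (intro tendsto_divide tendsto_of_real tendsto_norm_powr) auto
qed

context
  fixes p :: real
  assumes p: "1 < p"
begin

lemma unit_vector:
  fixes v :: "nat \<Rightarrow> 'k::real_normed_field"
  assumes v: "v \<in> carr (ell p)" "v \<noteq> 0"
  defines "u \<equiv> scl (ell p) (of_real (1 / nrm (ell p) v)) v"
  shows "u \<in> carr (ell p)" "nrm (ell p) u = 1" "psum p u = 1"
proof -
  interpret X: normed_carrier "ell p :: ('k, nat \<Rightarrow> 'k) nspace"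
    using p by (intro normed_carrier_ell) simp
  have "nrm (ell p) v \<noteq> 0"
    using v X.nrm_eq_0 by blast
  then show "u \<in> carr (ell p)" and "nrm (ell p) u = 1"
    using v by (simp_all add: u_def X.nrm_scl norm_divide)
  then show "psum p u = 1"
    using nrm_ell_powr[of p u] p by simp
qed

lemma ell_duality_closed:
  fixes v :: "nat \<Rightarrow> 'k::{real_normed_field, banach}"
  assumes v: "v \<in> carr (ell p)"
  shows "ell_duality p v \<in> carr (dual (ell p))"
proof -
  interpret X: normed_carrier "ell p :: ('k, nat \<Rightarrow> 'k) nspace"
    using p by (intro normed_carrier_ell) simp
  show ?thesis
    unfolding ell_duality_def using p v by (intro pairing_closed dual_seq_closed) simp_all
qed

text \<open>
  The coefficients have norm one in the conjugate space, so Hoelder's inequality bounds the functional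
  by one, and the evaluation at \<open>v\<close> shows that the bound is attained.
\<close>

lemma ell_duality_in_duality_map:
  fixes v :: "nat \<Rightarrow> 'k::{real_normed_field, banach}"
  assumes v: "v \<in> carr (ell p)" "v \<noteq> 0"
  shows "ell_duality p v \<in> duality_map (ell p) v"
proof -
  interpret X: normed_carrier "ell p :: ('k, nat \<Rightarrow> 'k) nspace"
    using p by (intro normed_carrier_ell) simp
  define u where "u = scl (ell p) (of_real (1 / nrm (ell p) v)) v"
  note u = unit_vector[OF v, folded u_def]
  have nv: "nrm (ell p) v \<noteq> 0"
    using v X.nrm_eq_0 by blast
  have "dual_seq p u k * v k = of_real (nrm (ell p) v * norm (u k) powr p)" for k
  proof -
    have "v k = of_real (nrm (ell p) v) * u k"
      using nv by (simp add: u_def scl_ell)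
    then show ?thesis
      using dual_seq_mult[of p u k] by (simp add: mult.left_commute)
  qed
  then have "ell_duality p v v = (\<Sum>k. of_real (nrm (ell p) v * norm (u k) powr p))"
    using v unfolding ell_duality_def pairing_def u_def[symmetric] by (simp del: of_real_mult)
  also have "\<dots> = of_real (\<Sum>k. nrm (ell p) v * norm (u k) powr p)"
    using u(1) by (intro suminf_of_real[symmetric] summable_mult) (simp add: carr_ell)
  also have "\<dots> = of_real (nrm (ell p) v)"
    using u(1,3) by (simp add: suminf_mult carr_ell psum_def)
  finally have eq: "ell_duality p v v = of_real (nrm (ell p) v)" .
  have "psum (conj_exp p) (dual_seq p u) = 1"
    using psum_dual_seq[OF p, of u] u(3) by simp
  then have "nrm (ell (conj_exp p)) (dual_seq p u) = 1"
    by (simp add: nrm_ell)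
  then have le: "nrm (dual (ell p)) (ell_duality p v) \<le> 1"
    using nrm_pairing_le[OF p dual_seq_closed[OF p u(1)]] unfolding ell_duality_def u_def[symmetric] by simp
  have "nrm (ell p) v \<le> nrm (dual (ell p)) (ell_duality p v) * nrm (ell p) v"
    using X.dual_bound[OF ell_duality_closed[OF v(1)] v(1)] by (simp add: eq)
  then have "1 \<le> nrm (dual (ell p)) (ell_duality p v)"
    using nv nrm_ell_nonneg[of p v] by (simp add: less_le)
  with le eq ell_duality_closed[OF v(1)] show ?thesis
    by (simp add: duality_map_def)
qed

text \<open>
  The coefficient sequences converge coordinatewise and all have norm one, so \<open>Radon_Riesz\<close>, applied in
  the conjugate space, turns this into norm convergence.
\<close>

lemma ell_duality_continuous:
  fixes v :: "nat \<Rightarrow> nat \<Rightarrow> 'k::{real_normed_field, banach}"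
  assumes v: "\<And>n. v n \<in> carr (ell p)" and v0: "v0 \<in> carr (ell p)" "v0 \<noteq> 0"
    and lim: "(\<lambda>n. nrm (ell p) (v n - v0)) \<longlonglongrightarrow> 0"
  shows "(\<lambda>n. nrm (dual (ell p)) (ell_duality p (v n) - ell_duality p v0)) \<longlonglongrightarrow> 0"
proof -
  interpret X: normed_carrier "ell p :: ('k, nat \<Rightarrow> 'k) nspace"
    using p by (intro normed_carrier_ell) simp
  interpret D: normed_carrier_pair "ell p :: ('k, nat \<Rightarrow> 'k) nspace" scalars
    by (rule X.normed_carrier_pair_dual)
  interpret Q: normed_carrier "ell (conj_exp p) :: ('k, nat \<Rightarrow> 'k) nspace"
    using conj_exp_gt_1[OF p] by (intro normed_carrier_ell) simp
  define u where "u w = scl (ell p) (of_real (1 / nrm (ell p) w)) w" for w :: "nat \<Rightarrow> 'k"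
  have nv0: "nrm (ell p) v0 \<noteq> 0"
    using v0 X.nrm_eq_0 by blast
  have nlim: "(\<lambda>n. nrm (ell p) (v n)) \<longlonglongrightarrow> nrm (ell p) v0"
    using X.tendsto_nrm[OF v v0(1) lim] .
  have coord: "(\<lambda>n. v n k) \<longlonglongrightarrow> v0 k" for k
  proof -
    have "norm (v n k - v0 k) \<le> nrm (ell p) (v n - v0)" for n
      using norm_le_nrm_ell[of p "v n - v0" k] p v v0 by simp
    then have "(\<lambda>n. v n k - v0 k) \<longlonglongrightarrow> 0"
      by (intro Lim_null_comparison[OF always_eventually lim]) auto
    then show ?thesis
      by (simp add: LIM_zero_iff)
  qed
  have ucoord: "(\<lambda>n. u (v n) k) \<longlonglongrightarrow> u v0 k" for k
    unfolding u_def scl_ell using nv0 by (intro tendsto_intros nlim coord)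
  have uc: "u w \<in> carr (ell p)" if "w \<in> carr (ell p)" for w
    using that by (simp add: u_def)
  have "\<forall>\<^sub>F n in sequentially. 0 < nrm (ell p) (v n)"
    using nlim nv0 by (intro order_tendstoD) (auto simp: less_le)
  then have "\<forall>\<^sub>F n in sequentially. psum (conj_exp p) (dual_seq p (u (v n))) = psum (conj_exp p) (dual_seq p (u v0))"
  proof eventually_elim
    case (elim n)
    then have "v n \<noteq> 0"
      by auto
    then show ?case
      using unit_vector(3)[OF v] unit_vector(3)[OF v0] by (simp add: psum_dual_seq p u_def)
  qed
  then have "(\<lambda>n. psum (conj_exp p) (dual_seq p (u (v n)))) \<longlonglongrightarrow> psum (conj_exp p) (dual_seq p (u v0))"
    by (rule tendsto_eventually)
  then have "(\<lambda>n. nrm (ell (conj_exp p)) (dual_seq p (u (v n)) - dual_seq p (u v0))) \<longlonglongrightarrow> 0"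
    by (intro Radon_Riesz conj_exp_gt_1 p dual_seq_closed uc v v0 tendsto_dual_seq ucoord)
  moreover have "nrm (dual (ell p)) (ell_duality p (v n) - ell_duality p v0)
      \<le> nrm (ell (conj_exp p)) (dual_seq p (u (v n)) - dual_seq p (u v0))" for n
    using nrm_pairing_le[OF p, of "dual_seq p (u (v n)) - dual_seq p (u v0)"]
      pairing_diff[OF p, of "dual_seq p (u (v n))" "dual_seq p (u v0)"] dual_seq_closed[OF p uc[OF v]]
      dual_seq_closed[OF p uc[OF v0(1)]]
    unfolding ell_duality_def u_def[symmetric] by simp
  moreover have "0 \<le> nrm (dual (ell p)) (ell_duality p (v n) - ell_duality p v0)" for n
    using normed_carrier.nrm_nonneg[OF D.normed_carrier_ops]
      normed_carrier.diff_closed[OF D.normed_carrier_ops] ell_duality_closed[OF v] ell_duality_closed[OF v0(1)]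
    by (simp add: dual_def)
  ultimately show ?thesis
    by (auto intro: Lim_null_comparison[rotated] always_eventually)
qed

subsection \<open>Functionals are pairings\<close>

text \<open>
  The coefficients are the values at the unit vectors. That they form a sequence of the conjugate space
  follows by testing the functional on truncations of their own dual sequence: with \<open>s\<close> the partial sum
  of the powers, this gives \<open>s \<le> \<parallel>\<phi>\<parallel> s\<^bsup>1/p\<^esup>\<close>. Truncations converge in norm, whence the series
  represents the functional everywhere.
\<close>

lemma functional_eq_pairing:
  fixes \<phi> :: "(nat \<Rightarrow> 'k::{real_normed_field, banach}) \<Rightarrow> 'k"
  assumes \<phi>: "\<phi> \<in> carr (dual (ell p))"
  obtains a where "a \<in> carr (ell (conj_exp p))" "\<phi> = pairing p a"
proof -
  let ?q = "conj_exp p"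
  interpret X: normed_carrier "ell p :: ('k, nat \<Rightarrow> 'k) nspace"
    using p by (intro normed_carrier_ell) simp
  interpret D: normed_carrier_pair "ell p :: ('k, nat \<Rightarrow> 'k) nspace" scalars
    by (rule X.normed_carrier_pair_dual)
  have \<phi>': "\<phi> \<in> carr D.B"
    using \<phi> by (simp add: dual_def)
  define a where "a k = \<phi> (unit_seq k)" for k
  have fin: "\<phi> (trunc x m) = (\<Sum>k<m. a k * x k)" for x m
  proof (induction m)
    case 0
    have "trunc x 0 = 0"
      by (simp add: trunc_def fun_eq_iff)
    then have "\<phi> (trunc x 0) = 0"
      by (simp only: D.op_zero[OF \<phi>'])
    then show ?case
      by (simp only: lessThan_0 sum.empty)
  next
    case (Suc m)
    have "trunc x (Suc m) = trunc x m + scl (ell p) (x m) (unit_seq m)"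
      by (auto simp: trunc_def scl_ell unit_seq_def fun_eq_iff less_Suc_eq)
    then have "\<phi> (trunc x (Suc m)) = \<phi> (trunc x m) + x m * a m"
      using D.op_add[OF \<phi>' trunc_closed X.scl_closed[OF unit_seq_closed]] D.op_scl[OF \<phi>' unit_seq_closed]
      by (simp add: a_def)
    then show ?case
      using Suc by (simp add: mult.commute)
  qed
  define N where "N = nrm (dual (ell p)) \<phi>"
  have N: "0 \<le> N"
    using D.op_norm_nonneg[OF \<phi>'] by (simp add: N_def dual_def)
  have bound: "(\<Sum>k<m. norm (a k) powr ?q) \<le> N powr ?q" for m
  proof -
    define s where "s = (\<Sum>k<m. norm (a k) powr ?q)"
    have s0: "0 \<le> s"
      by (auto simp: s_def intro: sum_nonneg)
    define y where "y = trunc (dual_seq ?q a) m"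
    have "psum p y = s"
      using norm_dual_seq_powr[OF conj_exp_gt_1[OF p], of a] p
      by (simp add: y_def psum_trunc s_def conj_exp_conj_exp)
    then have "nrm (ell p) y = s powr (1 / p)"
      by (simp add: nrm_ell)
    moreover have "\<phi> y = of_real s"
      unfolding y_def fin s_def of_real_sum
      by (intro sum.cong refl) (metis dual_seq_mult mult.commute)
    ultimately have le: "s \<le> N * s powr (1 / p)"
      using X.dual_bound[OF \<phi>, of y] s0 by (simp add: y_def trunc_closed N_def)
    show ?thesis
    proof (cases "s = 0")
      case False
      then have "0 < s"
        using s0 by simp
      have "s powr (1 / ?q) = s / s powr (1 / p)"
      proof -
        have "1 / ?q = 1 - 1 / p"
          using conj_exp_sum[OF p] by linarith
        then show ?thesis
          using \<open>0 < s\<close> powr_diff[of s 1 "1 / p"] by simp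
      qed
      also have "\<dots> \<le> N"
        using le \<open>0 < s\<close> by (simp add: divide_le_eq)
      finally have "(s powr (1 / ?q)) powr ?q \<le> N powr ?q"
        using conj_exp_gt_1[OF p] by (intro powr_mono2) auto
      then show ?thesis
        using conj_exp_gt_1[OF p] \<open>0 < s\<close> by (simp add: powr_powr s_def)
    qed (simp add: s_def)
  qed
  have a: "a \<in> carr (ell ?q)"
    unfolding carr_ell using bound by (intro summableI_nonneg_bounded) auto
  moreover have "\<phi> = pairing p a"
  proof
    fix x
    show "\<phi> x = pairing p a x"
    proof (cases "x \<in> carr (ell p)")
      case True
      have "(\<lambda>m. nrm (ell p) (trunc x m - x)) \<longlonglongrightarrow> 0"
      proof (rule Radon_Riesz[OF p trunc_closed True])
        show "(\<lambda>m. trunc x m k) \<longlonglongrightarrow> x k" for k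
          by (rule tendsto_eventually) (auto simp: trunc_def eventually_sequentially intro!: exI[of _ "Suc k"])
        show "(\<lambda>m. psum p (trunc x m)) \<longlonglongrightarrow> psum p x"
          using True unfolding psum_trunc unfolding psum_def carr_ell by (rule summable_LIMSEQ)
      qed
      then have lim: "(\<lambda>m. N * nrm (ell p) (trunc x m - x)) \<longlonglongrightarrow> 0"
        by (auto intro: tendsto_eq_intros)
      have "norm (\<phi> (trunc x m) - \<phi> x) \<le> N * nrm (ell p) (trunc x m - x)" for m
        using X.dual_bound[OF \<phi>, of "trunc x m - x"] D.op_diff[OF \<phi>' trunc_closed True] True
        by (simp add: trunc_closed N_def)
      then have "(\<lambda>m. \<phi> (trunc x m) - \<phi> x) \<longlonglongrightarrow> 0"
        by (intro Lim_null_comparison[OF always_eventually lim]) auto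
      then have "(\<lambda>m. \<Sum>k<m. a k * x k) \<longlonglongrightarrow> \<phi> x"
        by (simp add: LIM_zero_iff fin)
      then have "(\<Sum>k. a k * x k) = \<phi> x"
        by (intro sums_unique[symmetric]) (simp add: sums_def)
      then show ?thesis
        using True by (simp add: pairing_def)
    next
      case False
      then show ?thesis
        using D.op_outside[OF \<phi>'] by (simp add: pairing_def)
    qed
  qed
  ultimately show ?thesis
    using that by blast
qed

text \<open>
  Each coordinate of \<open>T x\<close> is a bounded functional of \<open>x\<close>, hence a pairing. The lemma is a form of weak
  continuity of \<open>T\<close>.
\<close>

lemma op_pointwise_null:
  fixes T :: "(nat \<Rightarrow> 'k::{real_normed_field, banach}) \<Rightarrow> nat \<Rightarrow> 'k"
  assumes q: "1 \<le> q" and T: "T \<in> carr (bounded_ops (ell p) (ell q))"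
    and z: "\<And>n. z n \<in> carr (ell p)" and C: "\<And>n. psum p (z n) \<le> C"
    and lim: "\<And>k. (\<lambda>n. z n k) \<longlonglongrightarrow> 0"
  shows "(\<lambda>n. T (z n) i) \<longlonglongrightarrow> 0"
proof -
  interpret X: normed_carrier "ell p :: ('k, nat \<Rightarrow> 'k) nspace"
    using p by (intro normed_carrier_ell) simp
  interpret Y: normed_carrier "ell q :: ('k, nat \<Rightarrow> 'k) nspace"
    using q by (rule normed_carrier_ell)
  interpret P: normed_carrier_pair "ell p :: ('k, nat \<Rightarrow> 'k) nspace" "ell q :: ('k, nat \<Rightarrow> 'k) nspace"
    by unfold_locales
  interpret D: normed_carrier_pair "ell p :: ('k, nat \<Rightarrow> 'k) nspace" scalars
    by (rule X.normed_carrier_pair_dual)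
  define \<phi> where "\<phi> x = T x i" for x
  have "\<phi> \<in> carr (dual (ell p))"
    unfolding dual_def
  proof (rule D.opI[where C = "nrm P.B T"])
    fix x :: "nat \<Rightarrow> 'k" assume x: "x \<in> carr (ell p)"
    show "nrm scalars (\<phi> x) \<le> nrm P.B T * nrm (ell p) x"
      using norm_le_nrm_ell[OF _ P.op_closed[OF T], of x i] P.op_norm_bound[OF T x] q
      by (simp add: \<phi>_def)
  qed (use P.op_outside[OF T] P.op_add[OF T] P.op_scl[OF T] in \<open>auto simp: \<phi>_def scl_ell\<close>)
  then obtain a where "a \<in> carr (ell (conj_exp p))" "\<phi> = pairing p a"
    by (rule functional_eq_pairing)
  then have "(\<lambda>n. \<phi> (z n)) \<longlonglongrightarrow> 0"
    using pairing_tendsto_0[OF p _ z C lim] by simp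
  then show ?thesis
    by (simp add: \<phi>_def)
qed

end

section \<open>Operators between sequence spaces\<close>

lemma normed_carrier_pair_ell:
  assumes "1 < p" "1 < q"
  shows "normed_carrier_pair (ell p :: ('k::real_normed_field, nat \<Rightarrow> 'k) nspace) (ell q)"
  using assms by (simp add: normed_carrier_pair_def normed_carrier_ell)

subsection \<open>Compact operators\<close>

lemma nrm_ell_minus_commute: "nrm (ell p) (x - y) = nrm (ell p) (y - x)"
  by (simp add: nrm_ell psum_def norm_minus_commute)

lemma Metric_space_ell:
  assumes p: "1 \<le> p"
  shows "Metric_space (carr (ell p)) (\<lambda>x y :: nat \<Rightarrow> 'k::real_normed_field. nrm (ell p) (x - y))"
proof -
  interpret X: normed_carrier "ell p :: ('k, nat \<Rightarrow> 'k) nspace"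
    using p by (rule normed_carrier_ell)
  show ?thesis
  proof
    show "nrm (ell p) (x - y) = nrm (ell p) (y - x)" for x y :: "nat \<Rightarrow> 'k"
      by (rule nrm_ell_minus_commute)
    show "(nrm (ell p) (x - y) = 0) = (x = y)"
      if "x \<in> carr (ell p)" "y \<in> carr (ell p)" for x y :: "nat \<Rightarrow> 'k"
      using X.nrm_eq_0[OF X.diff_closed[OF that]] X.nrm_zero by auto
    show "nrm (ell p) (x - z) \<le> nrm (ell p) (x - y) + nrm (ell p) (y - z)"
      if "x \<in> carr (ell p)" "y \<in> carr (ell p)" "z \<in> carr (ell p)" for x y z :: "nat \<Rightarrow> 'k"
      using X.nrm_triangle[of "x - y" "y - z"] that by simp
  qed simp
qed

text \<open>
  The images have a norm convergent subsequence, and its limit is zero because they tend to zero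
  coordinatewise.
\<close>

lemma compact_op_pointwise_null:
  fixes K :: "(nat \<Rightarrow> 'k::{real_normed_field, banach}) \<Rightarrow> nat \<Rightarrow> 'k"
  assumes p: "1 < p" and q: "1 < q" and K: "K \<in> compact_ops (ell p) (ell q)"
    and z: "\<And>n. z n \<in> carr (ell p)" and C: "\<And>n. nrm (ell p) (z n) \<le> C"
    and lim: "\<And>k. (\<lambda>n. z n k) \<longlonglongrightarrow> 0"
  obtains r where "strict_mono r" "(\<lambda>n. nrm (ell q) (K (z (r n)))) \<longlonglongrightarrow> 0"
proof -
  interpret P: normed_carrier_pair "ell p :: ('k, nat \<Rightarrow> 'k) nspace" "ell q :: ('k, nat \<Rightarrow> 'k) nspace"
    using p q by (rule normed_carrier_pair_ell)
  interpret M: Metric_space "carr (ell q)" "\<lambda>x y :: nat \<Rightarrow> 'k. nrm (ell q) (x - y)"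
    using q by (intro Metric_space_ell) simp
  have KB: "K \<in> carr P.B"
    and cpt: "compactin M.mtopology (M.mtopology closure_of (K ` unit_ball (ell p)))"
    using K by (auto simp: compact_ops_def norm_topology_def)
  define c where "c = \<bar>C\<bar> + 1"
  have c: "0 < c" "nrm (ell p) (z n) \<le> c" for n
    using C[of n] by (auto simp: c_def)
  define u where "u n = scl (ell p) (of_real (1 / c)) (z n)" for n
  have u: "u n \<in> unit_ball (ell p)" for n
    using c z by (simp add: u_def P.X.mem_unit_ball P.X.nrm_scl norm_divide)
  have Ku: "K (u n) \<in> carr (ell q)" for n
    using P.op_closed[OF KB] .
  have "K ` unit_ball (ell p) \<subseteq> M.mtopology closure_of (K ` unit_ball (ell p))"
    by (rule closure_of_subset) (use P.op_closed[OF KB] in auto)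
  then have "range (\<lambda>n. K (u n)) \<subseteq> M.mtopology closure_of (K ` unit_ball (ell p))"
    using u by auto
  then obtain l r where r: "strict_mono r" and "limitin M.mtopology ((\<lambda>n. K (u n)) \<circ> r) l sequentially"
    using cpt unfolding M.compactin_sequentially by meson
  then have l: "l \<in> carr (ell q)" "(\<lambda>n. nrm (ell q) (K (u (r n)) - l)) \<longlonglongrightarrow> 0"
    by (auto simp: M.limitin_metric_dist_null)
  have "l = 0"
  proof
    fix k
    have "norm (K (u (r n)) k - l k) \<le> nrm (ell q) (K (u (r n)) - l)" for n
      using norm_le_nrm_ell[of q "K (u (r n)) - l" k] q Ku l by simp
    then have "(\<lambda>n. K (u (r n)) k - l k) \<longlonglongrightarrow> 0"
      by (intro Lim_null_comparison[OF always_eventually l(2)]) auto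
    then have "(\<lambda>n. K (u (r n)) k) \<longlonglongrightarrow> l k"
      by (simp add: LIM_zero_iff)
    moreover have "(\<lambda>n. K (u (r n)) k) \<longlonglongrightarrow> 0"
    proof (rule op_pointwise_null[OF p _ KB])
      show "u (r n) \<in> carr (ell p)" "psum p (u (r n)) \<le> 1" for n
        using u[of "r n"] p nrm_ell_le_iff[of p "u (r n)" 1] by (auto simp: P.X.mem_unit_ball)
      have "(\<lambda>n. of_real (1 / c) * z (r n) k) \<longlonglongrightarrow> of_real (1 / c) * 0"
        using LIMSEQ_subseq_LIMSEQ[OF lim r, of k] by (intro tendsto_mult tendsto_const) (simp add: o_def)
      then show "(\<lambda>n. u (r n) k) \<longlonglongrightarrow> 0" for k
        using LIMSEQ_subseq_LIMSEQ[OF lim r, of k] tendsto_mult_left[of "\<lambda>n. z (r n) k" 0 sequentially "of_real (1 / c)"]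
        by (simp add: u_def scl_ell o_def)
    qed (use q in simp)
    ultimately show "l k = 0 k"
      using LIMSEQ_unique by fastforce
  qed
  then have "(\<lambda>n. c * nrm (ell q) (K (u (r n)))) \<longlonglongrightarrow> c * 0"
    using l(2) by (intro tendsto_mult tendsto_const) simp
  moreover have "c * nrm (ell q) (K (u n)) = nrm (ell q) (K (z n))" for n
    using c z P.op_closed[OF KB] by (simp add: u_def P.op_scl[OF KB] P.Y.nrm_scl norm_divide)
  ultimately show ?thesis
    using that[OF r] by simp
qed

text \<open>
  The image of the unit ball lies in the set of multiples of \<open>w\<close> by scalars of a compact ball; this
  set is compact, hence closed, and so contains the closure of the image.
\<close>

lemma rank_one_compact:
  fixes w :: "nat \<Rightarrow> 'k::{real_normed_field, euclidean_space}"
  assumes p: "1 < p" and q: "1 < q" and f: "f \<in> carr (dual (ell p))" and w: "w \<in> carr (ell q)"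
  shows "(\<lambda>h. scl (ell q) (f h) w) \<in> compact_ops (ell p) (ell q)"
proof -
  interpret P: normed_carrier_pair "ell p :: ('k, nat \<Rightarrow> 'k) nspace" "ell q :: ('k, nat \<Rightarrow> 'k) nspace"
    using p q by (rule normed_carrier_pair_ell)
  interpret D: normed_carrier_pair "ell p :: ('k, nat \<Rightarrow> 'k) nspace" scalars
    by (rule P.X.normed_carrier_pair_dual)
  interpret M: Metric_space "carr (ell q)" "\<lambda>x y :: nat \<Rightarrow> 'k. nrm (ell q) (x - y)"
    using q by (intro Metric_space_ell) simp
  have f': "f \<in> carr D.B"
    using f by (simp add: dual_def)
  define R where "R h = scl (ell q) (f h) w" for h
  have R: "R \<in> carr P.B"
  proof (rule P.opI[where C = "nrm (dual (ell p)) f * nrm (ell q) w"])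
    fix x :: "nat \<Rightarrow> 'k" assume x: "x \<in> carr (ell p)"
    show "nrm (ell q) (R x) \<le> nrm (dual (ell p)) f * nrm (ell q) w * nrm (ell p) x"
      using mult_right_mono[OF P.X.dual_bound[OF f x] nrm_ell_nonneg[of q w]] w
      by (simp add: R_def P.Y.nrm_scl mult.commute mult.left_commute)
    show "R x \<in> carr (ell q)"
      using w by (simp add: R_def)
    show "R (scl (ell p) c x) = scl (ell q) c (R x)" for c
      using D.op_scl[OF f' x] w by (simp add: R_def P.Y.scl_scl)
    show "R (x + y) = R x + R y" if "y \<in> carr (ell p)" for y
      using D.op_add[OF f' x that] w by (simp add: R_def P.Y.scl_add_left)
  next
    show "R x = 0" if "x \<notin> carr (ell p)" for x
      using D.op_outside[OF f' that] w by (simp add: R_def)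
  qed
  define N where "N = nrm (dual (ell p)) f"
  define S where "S = (\<lambda>c. scl (ell q) c w) ` cball 0 N"
  have S: "S \<subseteq> carr (ell q)"
    using w by (auto simp: S_def)
  have "compactin M.mtopology S"
    unfolding M.compactin_sequentially
  proof (intro conjI allI impI S)
    fix \<sigma> :: "nat \<Rightarrow> nat \<Rightarrow> 'k" assume "range \<sigma> \<subseteq> S"
    then have "\<exists>c. c \<in> cball 0 N \<and> \<sigma> n = scl (ell q) c w" for n
      unfolding S_def by blast
    then obtain c where c: "\<And>n. c n \<in> cball 0 N" "\<And>n. \<sigma> n = scl (ell q) (c n) w"
      by metis
    have "compact (cball (0::'k) N)"
      by simp
    then obtain d r where d: "d \<in> cball 0 N" "strict_mono r" "(c \<circ> r) \<longlonglongrightarrow> d"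
      using c(1) unfolding compact_def by meson
    have "scl (ell q) (c (r n)) w - scl (ell q) d w = scl (ell q) (c (r n) - d) w" for n
      using P.Y.scl_add_left[OF w, of "c (r n) - d" d] by simp
    then have "nrm (ell q) (\<sigma> (r n) - scl (ell q) d w) = norm (c (r n) - d) * nrm (ell q) w" for n
      using P.Y.nrm_scl[OF w] by (simp add: c(2))
    moreover have "(\<lambda>n. norm (c (r n) - d) * nrm (ell q) w) \<longlonglongrightarrow> 0"
      using d(3) by (intro tendsto_mult_left_zero tendsto_norm_zero) (simp add: LIM_zero_iff o_def)
    moreover have "scl (ell q) d w \<in> S"
      using d(1) by (auto simp: S_def)
    ultimately have "limitin M.mtopology (\<sigma> \<circ> r) (scl (ell q) d w) sequentially"
      using w by (simp add: M.limitin_metric_dist_null c(2))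
    then show "\<exists>l r. l \<in> S \<and> strict_mono r \<and> limitin M.mtopology (\<sigma> \<circ> r) l sequentially"
      using d(2) \<open>scl (ell q) d w \<in> S\<close> by blast
  qed
  moreover from this have "closedin M.mtopology S"
    by (rule compactin_imp_closedin[OF M.Hausdorff_space_mtopology])
  moreover have "R ` unit_ball (ell p) \<subseteq> S"
  proof
    fix y assume "y \<in> R ` unit_ball (ell p)"
    then obtain h where h: "h \<in> unit_ball (ell p)" "y = R h"
      by blast
    have "norm (f h) \<le> N"
      using D.op_norm_upper[OF f' h(1)] by (simp add: N_def dual_def)
    then show "y \<in> S"
      by (auto simp: S_def h(2) R_def)
  qed
  ultimately have "compactin M.mtopology (M.mtopology closure_of (R ` unit_ball (ell p)))"
    by (meson closed_compactin closedin_closure_of closure_of_minimal)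
  with R have "R \<in> compact_ops (ell p) (ell q)"
    by (simp add: compact_ops_def norm_topology_def)
  then show ?thesis
    unfolding R_def .
qed

lemma zero_compact:
  assumes "1 < p" "1 < q"
  shows "(0 :: (nat \<Rightarrow> 'k::{real_normed_field, euclidean_space}) \<Rightarrow> nat \<Rightarrow> 'k) \<in> compact_ops (ell p) (ell q)"
proof -
  interpret P: normed_carrier_pair "ell p :: ('k, nat \<Rightarrow> 'k) nspace" "ell q :: ('k, nat \<Rightarrow> 'k) nspace"
    using assms by (rule normed_carrier_pair_ell)
  interpret D: normed_carrier_pair "ell p :: ('k, nat \<Rightarrow> 'k) nspace" scalars
    by (rule P.X.normed_carrier_pair_dual)
  have "(0 :: (nat \<Rightarrow> 'k) \<Rightarrow> 'k) \<in> carr (dual (ell p))"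
    unfolding dual_def by (rule normed_carrier.zero_closed[OF D.normed_carrier_ops])
  from rank_one_compact[OF assms this P.Y.zero_closed] show ?thesis
    by (simp add: zero_fun_def scl_ell)
qed

lemma ess_norm_le:
  fixes T :: "(nat \<Rightarrow> 'k::{real_normed_field, euclidean_space}) \<Rightarrow> nat \<Rightarrow> 'k"
  assumes p: "1 < p" and q: "1 < q" and T: "T \<in> carr (bounded_ops (ell p) (ell q))"
    and K: "K \<in> compact_ops (ell p) (ell q)"
  shows "ess_norm (ell p) (ell q) T \<le> nrm (bounded_ops (ell p) (ell q)) (T - K)"
proof -
  interpret P: normed_carrier_pair "ell p :: ('k, nat \<Rightarrow> 'k) nspace" "ell q :: ('k, nat \<Rightarrow> 'k) nspace"
    using p q by (rule normed_carrier_pair_ell)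
  interpret Bs: normed_carrier P.B
    by (rule P.normed_carrier_ops)
  have "0 \<le> nrm P.B (T - K')" if "K' \<in> compact_ops (ell p) (ell q)" for K'
    using that T by (intro Bs.nrm_nonneg Bs.diff_closed) (auto simp: compact_ops_def)
  then show ?thesis
    unfolding ess_norm_def using K by (intro cINF_lower bdd_belowI2[where m = 0]) auto
qed

lemma ess_norm_lessE:
  fixes T :: "(nat \<Rightarrow> 'k::{real_normed_field, euclidean_space}) \<Rightarrow> nat \<Rightarrow> 'k"
  assumes p: "1 < p" and q: "1 < q" and less: "ess_norm (ell p) (ell q) T < d"
  obtains K where "K \<in> compact_ops (ell p) (ell q)" "nrm (bounded_ops (ell p) (ell q)) (T - K) < d"
proof -
  have ne: "(\<lambda>K. nrm (bounded_ops (ell p) (ell q)) (T - K)) ` compact_ops (ell p) (ell q) \<noteq> {}"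
    using zero_compact[OF p q] by blast
  show ?thesis
    using cInf_lessD[OF ne less[unfolded ess_norm_def]] that by blast
qed

subsection \<open>Norming sequences\<close>

text \<open>Cantor's diagonal argument.\<close>

lemma pointwise_convergent_subsequence:
  fixes x :: "nat \<Rightarrow> nat \<Rightarrow> 'k::{real_normed_vector, heine_borel}"
  assumes bound: "\<And>n k. norm (x n k) \<le> C"
  obtains r y where "strict_mono (r :: nat \<Rightarrow> nat)" "\<And>k. (\<lambda>n. x (r n) k) \<longlonglongrightarrow> y k"
proof -
  interpret subseqs "\<lambda>k s. convergent (\<lambda>n. x (s n) k)"
  proof
    fix k and s :: "nat \<Rightarrow> nat"
    have "bounded (range (\<lambda>n. x (s n) k))"
      using bound by (auto simp: bounded_iff)
    then obtain l r where "strict_mono r" "((\<lambda>n. x (s n) k) \<circ> r) \<longlonglongrightarrow> l"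
      using bounded_imp_convergent_subsequence by blast
    then show "\<exists>r. strict_mono r \<and> convergent (\<lambda>n. x ((s \<circ> r) n) k)"
      by (auto simp: convergent_def o_def)
  qed
  have "convergent (\<lambda>n. x (diagseq n) k)" for k
  proof -
    have "convergent (\<lambda>n. x ((diagseq \<circ> ((+) (Suc k))) n) k)"
    proof (rule diagseq_holds)
      fix r s :: "nat \<Rightarrow> nat" and k assume "strict_mono r" "convergent (\<lambda>n. x (s n) k)"
      then show "convergent (\<lambda>n. x ((s \<circ> r) n) k)"
        using convergent_subseq_convergent[of "\<lambda>n. x (s n) k" r] by (simp add: o_def)
    qed
    then show ?thesis
      using convergent_ignore_initial_segment[of "\<lambda>n. x (diagseq n) k" "Suc k"] by (simp add: add.commute)
  qed
  then have "\<exists>l. (\<lambda>n. x (diagseq n) k) \<longlonglongrightarrow> l" for k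
    by (simp add: convergent_def)
  then obtain y where "\<And>k. (\<lambda>n. x (diagseq n) k) \<longlonglongrightarrow> y k"
    by metis
  with subseq_diagseq that show ?thesis
    by blast
qed

lemma psum_op_le:
  fixes T :: "(nat \<Rightarrow> 'k::real_normed_field) \<Rightarrow> nat \<Rightarrow> 'k"
  assumes p: "1 < p" and q: "1 < q" and T: "T \<in> carr (bounded_ops (ell p) (ell q))" and x: "x \<in> carr (ell p)"
  shows "psum q (T x) \<le> nrm (bounded_ops (ell p) (ell q)) T powr q * psum p x powr (q / p)"
proof -
  interpret P: normed_carrier_pair "ell p :: ('k, nat \<Rightarrow> 'k) nspace" "ell q :: ('k, nat \<Rightarrow> 'k) nspace"
    using p q by (rule normed_carrier_pair_ell)
  have "psum q (T x) = nrm (ell q) (T x) powr q"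
    using P.op_closed[OF T, of x] q by (simp add: nrm_ell_powr)
  also have "\<dots> \<le> (nrm P.B T * nrm (ell p) x) powr q"
    using P.op_norm_bound[OF T x] q by (intro powr_mono2) auto
  also have "\<dots> = nrm P.B T powr q * psum p x powr (q / p)"
    using P.op_norm_nonneg[OF T] by (simp add: powr_mult nrm_ell powr_powr)
  finally show ?thesis .
qed

text \<open>
  For \<open>y\<close> in the unit ball compare \<open>y + s z\<^sub>n\<close> with its image. By \<open>Brezis_Lieb\<close> on both sides,
  \<open>\<parallel>T y\<parallel>\<^sup>q + s\<^sup>q \<beta> \<le> \<parallel>T\<parallel>\<^sup>q (1 + s\<^sup>p \<alpha>)\<^bsup>q/p\<^esup>\<close>, and the last exponent may be dropped since it is below one.
  The supremum over \<open>y\<close> cancels the leading terms and leaves \<open>\<beta> \<le> \<parallel>T\<parallel>\<^sup>q \<alpha> s\<^bsup>p-q\<^esup>\<close>, which vanishes as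
  \<open>s\<close> tends to zero.
\<close>

lemma Pitt:
  fixes T :: "(nat \<Rightarrow> 'k::{real_normed_field, banach}) \<Rightarrow> nat \<Rightarrow> 'k"
  assumes q: "1 < q" and pq: "q < p" and T: "T \<in> carr (bounded_ops (ell p) (ell q))"
    and z: "\<And>n. z n \<in> carr (ell p)" and lim: "\<And>k. (\<lambda>n. z n k) \<longlonglongrightarrow> 0"
    and \<alpha>: "(\<lambda>n. psum p (z n)) \<longlonglongrightarrow> \<alpha>" and \<beta>: "(\<lambda>n. psum q (T (z n))) \<longlonglongrightarrow> \<beta>"
  shows "\<beta> \<le> 0"
proof -
  have p: "1 < p"
    using q pq by simp
  interpret P: normed_carrier_pair "ell p :: ('k, nat \<Rightarrow> 'k) nspace" "ell q :: ('k, nat \<Rightarrow> 'k) nspace"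
    using p q by (rule normed_carrier_pair_ell)
  define \<tau> where "\<tau> = nrm P.B T"
  have \<tau>: "0 \<le> \<tau>"
    using P.op_norm_nonneg[OF T] by (simp add: \<tau>_def)
  have \<alpha>0: "0 \<le> \<alpha>"
    using \<alpha> by (rule LIMSEQ_le_const) (use psum_nonneg[OF z] in auto)
  have "Bseq (\<lambda>n. psum p (z n))" "Bseq (\<lambda>n. psum q (T (z n)))"
    using \<alpha> \<beta> by (auto intro!: convergent_imp_Bseq simp: convergent_def)
  then obtain C where C: "\<And>n. psum p (z n) \<le> C"
    by (auto simp: Bseq_def abs_le_iff)
  obtain C' where C': "\<And>n. psum q (T (z n)) \<le> C'"
    using \<open>Bseq (\<lambda>n. psum q (T (z n)))\<close> by (auto simp: Bseq_def abs_le_iff)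
  have Tc: "T x \<in> carr (ell q)" for x
    using P.op_closed[OF T] .
  have key: "\<tau> powr q + s powr q * \<beta> \<le> \<tau> powr q * (1 + s powr p * \<alpha>)" if s: "0 < s" for s
  proof -
    define d where "d = \<tau> powr q * (1 + s powr p * \<alpha>) - s powr q * \<beta>"
    define sz where "sz n = scl (ell p) (of_real s) (z n)" for n
    have szc: "sz n \<in> carr (ell p)" for n
      using z by (simp add: sz_def)
    have psz: "psum p (sz n) = s powr p * psum p (z n)" for n
      using z s by (simp add: sz_def scl_ell psum_scl)
    have Tsz: "T (sz n) = scl (ell q) (of_real s) (T (z n))" for n
      using P.op_scl[OF T z] by (simp add: sz_def)
    have pTsz: "psum q (T (sz n)) = s powr q * psum q (T (z n))" for n
      using Tc s by (simp add: Tsz scl_ell psum_scl)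
    have szlim: "(\<lambda>n. sz n k) \<longlonglongrightarrow> 0" for k
      using tendsto_mult_left[OF lim[of k], of "of_real s"] by (simp add: sz_def scl_ell)
    have "psum q (T y) \<le> d" if y: "y \<in> unit_ball (ell p)" for y
    proof -
      have yc: "y \<in> carr (ell p)" "psum p y \<le> 1"
        using y p nrm_ell_le_iff[of p y 1] by (auto simp: P.X.mem_unit_ball)
      have "(\<lambda>n. psum p (y + sz n) - psum p (sz n)) \<longlonglongrightarrow> psum p y"
        by (rule Brezis_Lieb[OF p yc(1) szc, where C = "s powr p * C"])
          (use C in \<open>auto simp: psz szlim intro: mult_left_mono\<close>)
      moreover have "(\<lambda>n. psum p (sz n)) \<longlonglongrightarrow> s powr p * \<alpha>"
        unfolding psz by (intro tendsto_mult tendsto_const \<alpha>)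
      ultimately have lim1: "(\<lambda>n. psum p (y + sz n)) \<longlonglongrightarrow> psum p y + s powr p * \<alpha>"
        using tendsto_add by fastforce
      have "(\<lambda>n. psum q (T y + T (sz n)) - psum q (T (sz n))) \<longlonglongrightarrow> psum q (T y)"
      proof (rule Brezis_Lieb[OF q Tc Tc, where C = "s powr q * C'"])
        show "psum q (T (sz n)) \<le> s powr q * C'" for n
          using C' by (auto simp: pTsz intro: mult_left_mono)
        show "(\<lambda>n. T (sz n) k) \<longlonglongrightarrow> 0" for k
          by (rule op_pointwise_null[OF p _ T szc _ szlim, where C = "s powr p * C"])
            (use C q in \<open>auto simp: psz intro: mult_left_mono\<close>)
      qed
      moreover have "(\<lambda>n. psum q (T (sz n))) \<longlonglongrightarrow> s powr q * \<beta>"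
        unfolding pTsz by (intro tendsto_mult tendsto_const \<beta>)
      ultimately have "(\<lambda>n. psum q (T y + T (sz n))) \<longlonglongrightarrow> psum q (T y) + s powr q * \<beta>"
        using tendsto_add by fastforce
      then have lim2: "(\<lambda>n. psum q (T (y + sz n))) \<longlonglongrightarrow> psum q (T y) + s powr q * \<beta>"
        using P.op_add[OF T yc(1) szc] by simp
      have lim1': "(\<lambda>n. \<tau> powr q * psum p (y + sz n) powr (q / p))
          \<longlonglongrightarrow> \<tau> powr q * (psum p y + s powr p * \<alpha>) powr (q / p)"
        using p q yc szc
        by (intro tendsto_mult tendsto_const tendsto_powr' lim1) (auto intro!: always_eventually psum_nonneg)
      have "psum q (T y) + s powr q * \<beta> \<le> \<tau> powr q * (psum p y + s powr p * \<alpha>) powr (q / p)"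
        by (rule LIMSEQ_le[OF lim2 lim1'])
          (use psum_op_le[OF p q T] yc szc in \<open>auto simp: \<tau>_def\<close>)
      also have "\<dots> \<le> \<tau> powr q * (1 + s powr p * \<alpha>) powr (q / p)"
        using p q yc \<alpha>0 psum_nonneg[OF yc(1)] by (intro mult_left_mono powr_mono2) auto
      also have "(1 + s powr p * \<alpha>) powr (q / p) \<le> (1 + s powr p * \<alpha>) powr 1"
        using p pq \<alpha>0 by (intro powr_mono) auto
      finally show ?thesis
        using \<alpha>0 by (simp add: d_def mult_left_mono)
    qed
    note d = this
    have "psum q (T 0) \<le> d"
      by (rule d) simp
    then have d0: "0 \<le> d"
      using psum_nonneg[OF Tc, of 0] by linarith
    have "\<tau> \<le> d powr (1 / q)"
      unfolding \<tau>_def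
    proof (rule P.op_norm_least)
      fix y :: "nat \<Rightarrow> 'k" assume "y \<in> unit_ball (ell p)"
      then show "nrm (ell q) (T y) \<le> d powr (1 / q)"
        using d q Tc d0 by (subst nrm_ell_le_iff) (auto simp: powr_powr)
    qed
    then have "\<tau> powr q \<le> (d powr (1 / q)) powr q"
      using \<tau> q by (intro powr_mono2) auto
    then show ?thesis
      using d0 q by (simp add: powr_powr d_def)
  qed
  have "\<beta> \<le> \<tau> powr q * \<alpha> * s powr (p - q)" if s: "0 < s" for s
  proof -
    have "s powr q * \<beta> \<le> \<tau> powr q * \<alpha> * s powr p"
      using key[OF s] by (simp add: algebra_simps)
    then show ?thesis
      using s by (simp add: powr_diff field_simps)
  qed
  moreover have "((\<lambda>s. \<tau> powr q * \<alpha> * s powr (p - q)) \<longlongrightarrow> \<tau> powr q * \<alpha> * 0 powr (p - q)) (at_right 0)"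
    using pq by (intro tendsto_mult tendsto_const tendsto_powr' tendsto_ident_at)
      (auto simp: eventually_at_right_field intro: exI[of _ 1])
  ultimately have "\<beta> \<le> \<tau> powr q * \<alpha> * 0 powr (p - q)"
    by (intro tendsto_lowerbound) (auto simp: eventually_at_right_field intro: gt_ex)
  then show ?thesis
    by simp
qed

text \<open>
  The coordinatewise limit \<open>y\<close> of a subsequence is a norm limit as soon as no mass \<open>\<alpha>\<close> escapes. Escaping mass
  costs: for \<open>p \<le> q\<close> \<open>T\<close> stretches it asymptotically by at most \<open>e < \<tau>\<close>, since a compact perturbation does
  not see it, and for \<open>q < p\<close> it is lost altogether by \<open>Pitt\<close>. Either way \<open>\<parallel>T\<parallel>\<close> would
  not be reached.
\<close>

lemma attaining_subsequence_ell:
  fixes T :: "(nat \<Rightarrow> 'k::{real_normed_field, euclidean_space}) \<Rightarrow> nat \<Rightarrow> 'k"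
  assumes p: "1 < p" and q: "1 < q" and T: "T \<in> carr (bounded_ops (ell p) (ell q))"
    and less: "ess_norm (ell p) (ell q) T < nrm (bounded_ops (ell p) (ell q)) T"
    and x: "\<And>n. x n \<in> unit_ball (ell p)"
    and nlim: "(\<lambda>n. nrm (ell q) (T (x n))) \<longlonglongrightarrow> nrm (bounded_ops (ell p) (ell q)) T"
  shows "\<exists>r y. strict_mono r \<and> y \<in> unit_ball (ell p) \<and> (\<lambda>n. nrm (ell p) (x (r n) - y)) \<longlonglongrightarrow> 0"
proof -
  interpret P: normed_carrier_pair "ell p :: ('k, nat \<Rightarrow> 'k) nspace" "ell q :: ('k, nat \<Rightarrow> 'k) nspace"
    using p q by (rule normed_carrier_pair_ell)
  interpret Bs: normed_carrier P.B
    by (rule P.normed_carrier_ops)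
  define \<tau> where "\<tau> = nrm P.B T"
  have Tc: "T x \<in> carr (ell q)" for x
    using P.op_closed[OF T] .
  have xc: "x n \<in> carr (ell p)" "nrm (ell p) (x n) \<le> 1" "psum p (x n) \<le> 1" for n
    using x[of n] p nrm_ell_le_iff[of p "x n" 1] by (auto simp: P.X.mem_unit_ball)
  have "norm (x n k) \<le> 1" for n k
    using norm_le_nrm_ell[of p "x n" k] xc[of n] p by simp
  then obtain r1 y where r1: "strict_mono (r1 :: nat \<Rightarrow> nat)" and y: "\<And>k. (\<lambda>n. x (r1 n) k) \<longlonglongrightarrow> y k"
    using pointwise_convergent_subsequence[of x 1] by metis
  have yc: "y \<in> carr (ell p)" "psum p y \<le> 1"
    using ell_pointwise_limit[of p "\<lambda>n. x (r1 n)" 1 y] xc y p by auto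
  then have yb: "y \<in> unit_ball (ell p)"
    using p by (simp add: P.X.mem_unit_ball nrm_ell_le_iff)
  define z where "z n = x (r1 n) - y" for n
  have zc: "z n \<in> carr (ell p)" for n
    using xc yc by (simp add: z_def)
  have nz: "nrm (ell p) (z n) \<le> 2" for n
    using P.X.nrm_triangle[of "x (r1 n)" "- y"] xc yc yb by (simp add: z_def P.X.mem_unit_ball) (smt (verit))
  have pz: "psum p (z n) \<le> 2 powr p" for n
    using nz[of n] nrm_ell_le_iff[of p "z n" 2] zc p by simp
  have zlim: "(\<lambda>n. z n k) \<longlonglongrightarrow> 0" for k
    using y[of k] by (simp add: z_def LIM_zero_iff)
  have pTz: "psum q (T (z n)) \<le> \<tau> powr q * (2 powr p) powr (q / p)" for n
  proof -
    have "psum p (z n) powr (q / p) \<le> (2 powr p) powr (q / p)"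
      using p q pz psum_nonneg[OF zc] by (intro powr_mono2) auto
    then show ?thesis
      using psum_op_le[OF p q T zc, of n] mult_left_mono[of _ _ "\<tau> powr q"]
      unfolding \<tau>_def by (meson order_trans powr_ge_zero)
  qed
  have Tzlim: "(\<lambda>n. T (z n) k) \<longlonglongrightarrow> 0" for k
    by (rule op_pointwise_null[OF p _ T zc pz zlim]) (use q in simp)
  have "norm (psum p (z n)) \<le> 2 powr p" "norm (psum q (T (z n))) \<le> \<tau> powr q * (2 powr p) powr (q / p)" for n
    using pz pTz psum_nonneg[OF zc] psum_nonneg[OF Tc] by auto
  then have "bounded (range (\<lambda>n. psum p (z n)) \<times> range (\<lambda>n. psum q (T (z n))))"
    by (intro bounded_Times) (auto simp: bounded_iff)
  then have "bounded (range (\<lambda>n. (psum p (z n), psum q (T (z n)))))"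
    by (rule bounded_subset) auto
  \<comment> \<open>Both norm sequences converge along one subsequence, by compactness in the plane.\<close>
  then obtain l r2 where r2: "strict_mono r2" "((\<lambda>n. (psum p (z n), psum q (T (z n)))) \<circ> r2) \<longlonglongrightarrow> l"
    using bounded_imp_convergent_subsequence by blast
  define \<alpha> where "\<alpha> = fst l"
  define \<beta> where "\<beta> = snd l"
  have \<alpha>: "(\<lambda>n. psum p (z (r2 n))) \<longlonglongrightarrow> \<alpha>" and \<beta>: "(\<lambda>n. psum q (T (z (r2 n)))) \<longlonglongrightarrow> \<beta>"
    using tendsto_fst[OF r2(2)] tendsto_snd[OF r2(2)] by (auto simp: \<alpha>_def \<beta>_def o_def)
  have zlim2: "(\<lambda>n. z (r2 n) k) \<longlonglongrightarrow> 0" and Tzlim2: "(\<lambda>n. T (z (r2 n)) k) \<longlonglongrightarrow> 0" for k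
    using LIMSEQ_subseq_LIMSEQ[OF zlim r2(1)] LIMSEQ_subseq_LIMSEQ[OF Tzlim r2(1)] by (simp_all add: o_def)
  define r where "r = (\<lambda>n. r1 (r2 n))"
  have r: "strict_mono r"
    using strict_mono_o[OF r1 r2(1)] by (simp add: r_def o_def)
  have xr: "x (r n) = y + z (r2 n)" for n
    by (simp add: z_def r_def)
  have \<alpha>0: "0 \<le> \<alpha>" and \<beta>0: "0 \<le> \<beta>"
    using LIMSEQ_le_const[OF \<alpha>, of 0] LIMSEQ_le_const[OF \<beta>, of 0] psum_nonneg[OF zc] psum_nonneg[OF Tc] by auto
  define \<eta> where "\<eta> = psum p y"
  have \<eta>0: "0 \<le> \<eta>"
    using psum_nonneg[OF yc(1)] by (simp add: \<eta>_def)
  have domain: "\<eta> + \<alpha> \<le> 1"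
  proof -
    have "(\<lambda>n. psum p (y + z (r2 n)) - psum p (z (r2 n))) \<longlonglongrightarrow> \<eta>"
      unfolding \<eta>_def by (rule Brezis_Lieb[OF p yc(1) zc pz zlim2])
    from tendsto_add[OF this \<alpha>] have "(\<lambda>n. psum p (x (r n))) \<longlonglongrightarrow> \<eta> + \<alpha>"
      by (simp add: xr)
    then show ?thesis
      by (rule LIMSEQ_le_const2) (use xc in auto)
  qed
  have range: "\<tau> powr q = psum q (T y) + \<beta>"
  proof (rule LIMSEQ_unique)
    have "(\<lambda>n. psum q (T y + T (z (r2 n))) - psum q (T (z (r2 n)))) \<longlonglongrightarrow> psum q (T y)"
      by (rule Brezis_Lieb[OF q Tc Tc pTz Tzlim2])
    from tendsto_add[OF this \<beta>] show "(\<lambda>n. psum q (T (x (r n)))) \<longlonglongrightarrow> psum q (T y) + \<beta>"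
      using P.op_add[OF T yc(1) zc] by (simp add: xr)
    have "(\<lambda>n. nrm (ell q) (T (x (r n))) powr q) \<longlonglongrightarrow> \<tau> powr q"
      using LIMSEQ_subseq_LIMSEQ[OF nlim r] q unfolding \<tau>_def[symmetric]
      by (intro tendsto_powr' tendsto_const) (auto simp: o_def)
    then show "(\<lambda>n. psum q (T (x (r n)))) \<longlonglongrightarrow> \<tau> powr q"
      using Tc q by (simp add: nrm_ell_powr)
  qed
  have Ty: "psum q (T y) \<le> \<tau> powr q * \<eta> powr (q / p)"
    using psum_op_le[OF p q T yc(1)] by (simp add: \<tau>_def \<eta>_def)
  obtain K where K: "K \<in> compact_ops (ell p) (ell q)" "nrm P.B (T - K) < \<tau>"
    using ess_norm_lessE[OF p q less] by (auto simp: \<tau>_def)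
  define e where "e = nrm P.B (T - K)"
  have KB: "K \<in> carr P.B"
    using K by (simp add: compact_ops_def)
  have TK: "T - K \<in> carr P.B"
    using T KB by simp
  have e: "0 \<le> e" "e < \<tau>"
    using Bs.nrm_nonneg[OF TK] K by (auto simp: e_def)
  then have e_less: "e powr q < \<tau> powr q"
    using q by (intro powr_less_mono2) auto
  have "\<alpha> = 0"
  proof (cases "p \<le> q")
    case True
    obtain r3 where r3: "strict_mono r3" "(\<lambda>n. nrm (ell q) (K (z (r2 (r3 n))))) \<longlonglongrightarrow> 0"
      using compact_op_pointwise_null[OF p q K(1) zc nz zlim2] by blast
    have \<alpha>3: "(\<lambda>n. psum p (z (r2 (r3 n)))) \<longlonglongrightarrow> \<alpha>" and \<beta>3: "(\<lambda>n. psum q (T (z (r2 (r3 n))))) \<longlonglongrightarrow> \<beta>"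
      using LIMSEQ_subseq_LIMSEQ[OF \<alpha> r3(1)] LIMSEQ_subseq_LIMSEQ[OF \<beta> r3(1)] by (simp_all add: o_def)
    have "\<beta> powr (1 / q) \<le> e * \<alpha> powr (1 / p) + 0"
    proof (rule LIMSEQ_le)
      show "(\<lambda>n. nrm (ell q) (T (z (r2 (r3 n))))) \<longlonglongrightarrow> \<beta> powr (1 / q)"
        unfolding nrm_ell using q psum_nonneg[OF Tc]
        by (intro tendsto_powr' \<beta>3 tendsto_const) auto
      have "(\<lambda>n. nrm (ell p) (z (r2 (r3 n)))) \<longlonglongrightarrow> \<alpha> powr (1 / p)"
        unfolding nrm_ell using p psum_nonneg[OF zc]
        by (intro tendsto_powr' \<alpha>3 tendsto_const) auto
      then show "(\<lambda>n. e * nrm (ell p) (z (r2 (r3 n))) + nrm (ell q) (K (z (r2 (r3 n)))))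
          \<longlonglongrightarrow> e * \<alpha> powr (1 / p) + 0"
        by (intro tendsto_add tendsto_mult tendsto_const r3(2))
      have "nrm (ell q) (T (z n)) \<le> e * nrm (ell p) (z n) + nrm (ell q) (K (z n))" for n
        using P.op_norm_bound[OF TK zc, of n] P.Y.nrm_triangle[of "(T - K) (z n)" "K (z n)"]
          P.op_closed[OF KB] Tc by (simp add: e_def)
      then show "\<exists>N. \<forall>n\<ge>N. nrm (ell q) (T (z (r2 (r3 n))))
          \<le> e * nrm (ell p) (z (r2 (r3 n))) + nrm (ell q) (K (z (r2 (r3 n))))"
        by blast
    qed
    then have "(\<beta> powr (1 / q)) powr q \<le> (e * \<alpha> powr (1 / p)) powr q"
      using q by (intro powr_mono2) auto
    then have \<beta>_le: "\<beta> \<le> e powr q * \<alpha> powr (q / p)"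
      using q \<beta>0 e by (simp add: powr_powr powr_mult)
    have shrink: "c powr (q / p) \<le> c" if "0 \<le> c" "c \<le> 1" for c :: real
      using powr_mono'[of 1 "q / p" c] that True p by simp
    have "\<tau> powr q \<le> \<tau> powr q * \<eta> + e powr q * \<alpha>"
    proof -
      have "\<tau> powr q * \<eta> powr (q / p) \<le> \<tau> powr q * \<eta>" "e powr q * \<alpha> powr (q / p) \<le> e powr q * \<alpha>"
        using shrink[of \<eta>] shrink[of \<alpha>] domain \<eta>0 \<alpha>0 by (auto intro: mult_left_mono)
      then show ?thesis
        using range Ty \<beta>_le by linarith
    qed
    also have "\<dots> \<le> \<tau> powr q * (1 - \<alpha>) + e powr q * \<alpha>"
      using domain by (intro add_right_mono mult_left_mono) auto
    finally have "(\<tau> powr q - e powr q) * \<alpha> \<le> 0"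
      by (simp add: algebra_simps)
    then show ?thesis
      using \<alpha>0 e_less by (simp add: mult_le_0_iff)
  next
    case False
    then have "\<beta> \<le> 0"
      using Pitt[OF q _ T zc zlim2 \<alpha> \<beta>] by simp
    then have "\<tau> powr q * 1 \<le> \<tau> powr q * \<eta> powr (q / p)"
      using range Ty by simp
    then have "1 \<le> \<eta> powr (q / p)"
      using e_less powr_ge_zero[of e q] by (subst (asm) mult_le_cancel_left_pos) auto
    moreover have "\<eta> powr (q / p) < 1" if "\<eta> < 1"
      using powr_less_mono2[of "q / p" \<eta> 1] that \<eta>0 p q by simp
    ultimately show ?thesis
      using domain \<alpha>0 by fastforce
  qed
  then have "(\<lambda>n. nrm (ell p) (z (r2 n))) \<longlonglongrightarrow> 0"
    using \<alpha> zc p by (subst tendsto_nrm_ell_zero_iff) auto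
  then have "(\<lambda>n. nrm (ell p) (x (r n) - y)) \<longlonglongrightarrow> 0"
    by (simp add: xr)
  with r yb show ?thesis
    by blast
qed

subsection \<open>Strong subdifferentiability\<close>

lemma ess_norm_less_imp_SSD:
  fixes T :: "(nat \<Rightarrow> 'k::{real_normed_field, euclidean_space}) \<Rightarrow> nat \<Rightarrow> 'k"
  assumes p: "1 < p" and q: "1 < q" and T: "T \<in> carr (bounded_ops (ell p) (ell q))"
    and less: "ess_norm (ell p) (ell q) T < nrm (bounded_ops (ell p) (ell q)) T"
  shows "T \<in> SSD (bounded_ops (ell p) (ell q))"
proof -
  interpret P: normed_carrier_pair "ell p :: ('k, nat \<Rightarrow> 'k) nspace" "ell q :: ('k, nat \<Rightarrow> 'k) nspace"
    using p q by (rule normed_carrier_pair_ell)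
  interpret Bs: normed_carrier P.B
    by (rule P.normed_carrier_ops)
  obtain K where K: "K \<in> compact_ops (ell p) (ell q)" "nrm P.B (T - K) < nrm P.B T"
    using ess_norm_lessE[OF p q less] .
  have "0 \<le> nrm P.B (T - K)"
    using K T by (intro Bs.nrm_nonneg Bs.diff_closed) (auto simp: compact_ops_def)
  with K have pos: "0 < nrm P.B T"
    by simp
  interpret compactly_attaining_op "ell p" "ell q" T "ell_duality q"
  proof
    show "\<exists>r x0. strict_mono r \<and> x0 \<in> unit_ball (ell p) \<and> (\<lambda>n. nrm (ell p) (x (r n) - x0)) \<longlonglongrightarrow> 0"
      if "\<And>n. x n \<in> unit_ball (ell p)" "(\<lambda>n. nrm (ell q) (T (x n))) \<longlonglongrightarrow> nrm P.B T" for x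
      using attaining_subsequence_ell[OF p q T less that] .
  qed (use T pos q in \<open>auto intro: ell_duality_closed ell_duality_in_duality_map ell_duality_continuous\<close>)
  show ?thesis
    by (rule op_in_SSD)
qed

text \<open>
  Let \<open>x\<close> be a unit vector with \<open>\<parallel>T x\<parallel> > \<parallel>T\<parallel> - \<delta>\<close>, \<open>f\<close> a norming functional of \<open>x\<close>, and \<open>w\<close> a unit vector
  in the direction of \<open>T x\<close>. Adding \<open>R h = \<delta> f(h) w\<close> to \<open>T\<close> lengthens the image of \<open>x\<close> by \<open>\<delta>\<close>, which
  lifts the norm above \<open>\<parallel>T\<parallel>\<close>; as \<open>R\<close> is compact, the essential norm remains at most \<open>\<parallel>T\<parallel>\<close>.
\<close>

lemma ess_norm_less_approx:
  fixes T :: "(nat \<Rightarrow> 'k::{real_normed_field, euclidean_space}) \<Rightarrow> nat \<Rightarrow> 'k"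
  assumes p: "1 < p" and q: "1 < q" and T: "T \<in> carr (bounded_ops (ell p) (ell q))" and \<epsilon>: "0 < \<epsilon>"
  obtains A where "A \<in> carr (bounded_ops (ell p) (ell q))" "nrm (bounded_ops (ell p) (ell q)) (T - A) < \<epsilon>"
    "ess_norm (ell p) (ell q) A < nrm (bounded_ops (ell p) (ell q)) A"
proof -
  interpret P: normed_carrier_pair "ell p :: ('k, nat \<Rightarrow> 'k) nspace" "ell q :: ('k, nat \<Rightarrow> 'k) nspace"
    using p q by (rule normed_carrier_pair_ell)
  interpret Bs: normed_carrier P.B
    by (rule P.normed_carrier_ops)
  define \<delta> where "\<delta> = \<epsilon> / 2"
  have \<delta>: "0 < \<delta>" "\<delta> < \<epsilon>"
    using \<epsilon> by (auto simp: \<delta>_def)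
  have "\<exists>x \<in> carr (ell p). nrm (ell p) x = 1 \<and> nrm P.B T - \<delta> < nrm (ell q) (T x)"
  proof -
    have "nrm P.B T - \<delta> < nrm P.B T"
      using \<delta> by simp
    then obtain y where y: "y \<in> unit_ball (ell p)" "nrm P.B T - \<delta> < nrm (ell q) (T y)"
      using P.op_norm_approx[OF T] by blast
    then have yc: "y \<in> carr (ell p)" "nrm (ell p) y \<le> 1"
      by (auto simp: P.X.mem_unit_ball)
    show ?thesis
    proof (cases "y = 0")
      case True
      \<comment> \<open>Then \<open>\<parallel>T\<parallel> < \<delta>\<close>, and every unit vector will do.\<close>
      then have "nrm P.B T - \<delta> < 0"
        using y(2) P.op_zero[OF T] by simp
      then have "nrm P.B T - \<delta> < nrm (ell q) (T (unit_seq 0))"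
        by (rule less_le_trans) simp
      then show ?thesis
        using unit_seq_closed nrm_unit_seq by blast
    next
      case False
      define n where "n = nrm (ell p) y"
      have n: "0 < n" "n \<le> 1"
        using yc False P.X.nrm_eq_0[OF yc(1)] by (auto simp: n_def less_le)
      define x where "x = scl (ell p) (of_real (1 / n)) y"
      have "x \<in> carr (ell p)" "nrm (ell p) x = 1"
        using yc n by (simp_all add: x_def P.X.nrm_scl norm_divide flip: n_def)
      moreover have "nrm (ell q) (T y) \<le> nrm (ell q) (T x)"
      proof -
        have "nrm (ell q) (T x) = nrm (ell q) (T y) / n"
          using n P.op_scl[OF T yc(1)] P.op_closed[OF T] by (simp add: x_def P.Y.nrm_scl norm_divide)
        then show ?thesis
          using n mult_left_mono[of n 1 "nrm (ell q) (T y)"] by (simp add: le_divide_eq)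
      qed
      ultimately show ?thesis
        using y(2) by (intro bexI[of _ x]) auto
    qed
  qed
  then obtain x where x: "x \<in> carr (ell p)" "nrm (ell p) x = 1" "nrm P.B T - \<delta> < nrm (ell q) (T x)"
    by blast
  define m where "m = nrm (ell q) (T x)"
  have Tx: "T x \<in> carr (ell q)"
    using P.op_closed[OF T] .
  obtain w where w: "w \<in> carr (ell q)" "nrm (ell q) w = 1" "T x = scl (ell q) (of_real m) w"
  proof (cases "m = 0")
    case True
    then have "T x = scl (ell q) (of_real m) (unit_seq 0)"
      using P.Y.nrm_eq_0[OF Tx] P.Y.scl_zero_left[OF unit_seq_closed] by (simp add: m_def)
    then show ?thesis
      using that[of "unit_seq 0"] unit_seq_closed nrm_unit_seq by blast
  next
    case False
    have "0 < m"
      using False by (simp add: m_def less_le)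
    show ?thesis
      using that[of "scl (ell q) (of_real (1 / m)) (T x)"] Tx \<open>0 < m\<close>
      by (simp add: P.Y.nrm_scl P.Y.scl_scl norm_divide flip: m_def)
  qed
  define f where "f = ell_duality p x"
  have x0: "x \<noteq> 0"
    using x(2) by auto
  have f: "f \<in> carr (dual (ell p))" "nrm (dual (ell p)) f = 1" "f x = 1"
    using ell_duality_in_duality_map[OF p x(1) x0] x(2) by (auto simp: duality_map_def f_def)
  define R where "R = (\<lambda>h. scl (ell q) (f h) (scl (ell q) (of_real \<delta>) w))"
  have R: "R \<in> compact_ops (ell p) (ell q)"
    unfolding R_def using w by (intro rank_one_compact p q f) simp
  then have RB: "R \<in> carr P.B"
    by (simp add: compact_ops_def)
  have nR: "nrm P.B R \<le> \<delta>"
  proof (rule P.op_norm_le)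
    fix h :: "nat \<Rightarrow> 'k" assume h: "h \<in> carr (ell p)"
    show "nrm (ell q) (R h) \<le> \<delta> * nrm (ell p) h"
      using P.X.dual_bound[OF f(1) h] f(2) w \<delta> by (simp add: R_def P.Y.nrm_scl)
  qed (use \<delta> in simp)
  define A where "A = T + R"
  have A: "A \<in> carr P.B"
    using T RB by (simp add: A_def)
  have "A x = scl (ell q) (of_real (m + \<delta>)) w"
    using w f(3) by (simp add: A_def R_def P.Y.scl_add_left)
  moreover have "0 \<le> m"
    by (simp add: m_def)
  ultimately have "nrm (ell q) (A x) = m + \<delta>"
    using w \<delta> by (simp add: P.Y.nrm_scl del: of_real_add)
  then have "nrm P.B T < nrm P.B A"
    using P.op_norm_bound[OF A x(1)] x by (simp add: m_def)
  moreover have "ess_norm (ell p) (ell q) A \<le> nrm P.B T"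
    using ess_norm_le[OF p q A R] by (simp add: A_def)
  moreover have "nrm P.B (T - A) < \<epsilon>"
    using Bs.nrm_minus[OF RB] nR \<delta> by (simp add: A_def)
  ultimately show ?thesis
    using that[OF A] by linarith
qed

lemma SSD_dense:
  assumes p: "1 < p" and q: "1 < q"
  shows "dense_in (bounded_ops (ell p) (ell q))
    (SSD (bounded_ops (ell p) (ell q :: ('k::{real_normed_field, euclidean_space}, nat \<Rightarrow> 'k) nspace)))"
  unfolding dense_in_def
proof (intro conjI ballI allI impI)
  show "SSD (bounded_ops (ell p) (ell q :: ('k, nat \<Rightarrow> 'k) nspace)) \<subseteq> carr (bounded_ops (ell p) (ell q))"
    by (auto simp: SSD_def)
  fix T :: "(nat \<Rightarrow> 'k) \<Rightarrow> nat \<Rightarrow> 'k" and \<epsilon> :: real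
  assume "T \<in> carr (bounded_ops (ell p) (ell q))" "0 < \<epsilon>"
  then obtain A where "A \<in> carr (bounded_ops (ell p) (ell q))" "nrm (bounded_ops (ell p) (ell q)) (T - A) < \<epsilon>"
    "ess_norm (ell p) (ell q) A < nrm (bounded_ops (ell p) (ell q)) A"
    by (rule ess_norm_less_approx[OF p q])
  then show "\<exists>A\<in>SSD (bounded_ops (ell p) (ell q)). nrm (bounded_ops (ell p) (ell q)) (T - A) < \<epsilon>"
    using ess_norm_less_imp_SSD[OF p q] by blast
qed

theorem theorem3p1:
  fixes p q :: real
  assumes "1 < p" and "1 < q"
  shows
    "({T \<in> carr (bounded_ops (ell p) (ell q)).
        ess_norm (ell p) (ell q) T < nrm (bounded_ops (ell p) (ell q)) T}
      \<subseteq> SSD (bounded_ops (ell p) (ell q :: (real, nat \<Rightarrow> real) nspace)) \<and>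
     dense_in (bounded_ops (ell p) (ell q))
      (SSD (bounded_ops (ell p) (ell q :: (real, nat \<Rightarrow> real) nspace)))) \<and>
     ({T \<in> carr (bounded_ops (ell p) (ell q)).
        ess_norm (ell p) (ell q) T < nrm (bounded_ops (ell p) (ell q)) T}
      \<subseteq> SSD (bounded_ops (ell p) (ell q :: (complex, nat \<Rightarrow> complex) nspace)) \<and>
     dense_in (bounded_ops (ell p) (ell q))
      (SSD (bounded_ops (ell p) (ell q :: (complex, nat \<Rightarrow> complex) nspace))))"
  using ess_norm_less_imp_SSD[OF assms, where 'k = real] SSD_dense[OF assms, where 'k = real]
    ess_norm_less_imp_SSD[OF assms, where 'k = complex] SSD_dense[OF assms, where 'k = complex]
  by blast

end
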